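(* Let $(a,b,c)$ be a primitive positive definite form of discriminant $\Delta<0$, let $p$ be a prime, and let $G$ be a genus of discriminant $\Delta p^2$ such that $\Psi_{G,p}(a,b,c):=\Psi_p(a,b,c)\cap G$ is nonempty. Let $r$ be a positive integer coprime to $\Delta p^2$ that is represented by a form of $\Psi_{G,p}(a,b,c)$. If $p$ is odd, then $$w\sum_{(A,B,C)\in\Psi_{G,p}(a,b,c)}(A,B,C,q)=w\,|\Psi_{G,p}(a,b,c)|\,(a,b,c,q^{p^2})+\sum_{i=1}^{p-1}\frac{\left(\frac{ri}{p}\right)+1}{2}\,P_{p,i}(a,b,c,q),$$ and if $p=2$, then $$w\sum_{(A,B,C)\in\Psi_{G,2}(a,b,c)}(A,B,C,q)=w\,|\Psi_{G,2}(a,b,c)|\,(a,b,c,q^{4})+P_{2^{t+1},\,r'}(a,b,c,q),$$ where $r'$ is the least nonnegative residue of $r$ modulo $2^{t+1}$, and $t=2$ if $\Delta\equiv0\pmod{16}$, while for $\Delta\not\equiv0\pmod{16}$, $t=0$ if $\Delta$ is odd and $t=1$ if $\Delta$ is even.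
   Context: A form $(a,b,c)$ denotes the $SL(2,\mathbb Z)$-equivalence class of the positive definite form $ax^2+bxy+cy^2$ ($a>0$) of discriminant $b^2-4ac<0$; it is primitive if $\gcd(a,b,c)=1$, and $\mathrm{CL}(\Delta)$ is the set of classes of primitive forms of discriminant $\Delta$. Two primitive forms of discriminant $D$ are in the same genus if they are equivalent via a matrix in $SL(2,\mathbb Q)$ whose entries have denominators coprime to $2D$ (equivalently, they have the same values of the assigned characters of $D$); the genera partition $\mathrm{CL}(D)$. The theta series $(a,b,c,q):=\sum_{(x,y)\in\mathbb Z^2}q^{ax^2+bxy+cy^2}$ depends only on the class; $(a,b,c,q^k)$ is this series with $q\mapsto q^k$. For $m\ge1$, $0\le r<m$: $P_{m,r}\sum_{n\ge0}a(n)q^n=\sum_{n\ge0}a(mn+r)q^{mn+r}$. $\left(\frac{\cdot}{p}\right)$ is the Legendre symbol for odd $p$. $w=3$ if $\Delta=-3$, $w=2$ if $\Delta=-4$, $w=1$ if $\Delta<-4$. For a prime $p$ and primitive $(a,b,c)$ of discriminant $\Delta$, $\Psi_p(a,b,c)$ is the set of distinct classes of primitive forms occurring in the list $(a,bp,cp^2)$, $(ap^2,\,p(b+2ah),\,ah^2+bh+c)$ ($0\le h<p$) of forms of discriminant $\Delta p^2$ (a subset of $\mathrm{CL}(\Delta p^2)$, depending only on the class of $(a,b,c)$). *)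

theory Defs
  imports Complex_Main "HOL-Number_Theory.Number_Theory"
begin

type_synonym form = "int \<times> int \<times> int"

definition fval :: "form \<Rightarrow> int \<Rightarrow> int \<Rightarrow> int" where
  "fval f x y = (case f of (a,b,c) \<Rightarrow> a*x^2 + b*x*y + c*y^2)"

definition disc :: "form \<Rightarrow> int" where
  "disc f = (case f of (a,b,c) \<Rightarrow> b^2 - 4*a*c)"

definition posdef :: "form \<Rightarrow> bool" where
  "posdef f = (case f of (a,b,c) \<Rightarrow> a > 0 \<and> b^2 - 4*a*c < 0)"

definition primitive :: "form \<Rightarrow> bool" where
  "primitive f = (case f of (a,b,c) \<Rightarrow> gcd a (gcd b c) = 1)"

text \<open>Coefficients of the form f(al x + be y, ga x + de y) (over any comm ring).\<close>
definition transf :: "'a::comm_ring_1 \<times> 'a \<times> 'a \<Rightarrow> 'a \<Rightarrow> 'a \<Rightarrow> 'a \<Rightarrow> 'a \<Rightarrow> 'a \<times> 'a \<times> 'a" where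
  "transf f al be ga de = (case f of (a,b,c) \<Rightarrow>
     (a*al^2 + b*al*ga + c*ga^2,
      2*a*al*be + b*(al*de + be*ga) + 2*c*ga*de,
      a*be^2 + b*be*de + c*de^2))"

definition sl2_equiv :: "form \<Rightarrow> form \<Rightarrow> bool" where
  "sl2_equiv f g = (\<exists>al be ga de::int. al*de - be*ga = 1 \<and> g = transf f al be ga de)"

definition cls :: "form \<Rightarrow> form set" where
  "cls f = {g. sl2_equiv f g}"

definition CL :: "int \<Rightarrow> form set set" where
  "CL D = {cls f | f. primitive f \<and> posdef f \<and> disc f = D}"

definition ratform :: "form \<Rightarrow> rat \<times> rat \<times> rat" where
  "ratform f = (case f of (a,b,c) \<Rightarrow> (of_int a, of_int b, of_int c))"

definition genus_rel :: "int \<Rightarrow> form \<Rightarrow> form \<Rightarrow> bool" where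
  "genus_rel D f g = (\<exists>al be ga de::rat. al*de - be*ga = 1 \<and>
      (\<forall>z\<in>{al,be,ga,de}. coprime (snd (quotient_of z)) (2*D)) \<and>
      ratform g = transf (ratform f) al be ga de)"

definition genus :: "int \<Rightarrow> form \<Rightarrow> form set set" where
  "genus D f = {cls g | g. primitive g \<and> posdef g \<and> disc g = D \<and> genus_rel D f g}"

definition is_genus :: "int \<Rightarrow> form set set \<Rightarrow> bool" where
  "is_genus D G = (\<exists>f. primitive f \<and> posdef f \<and> disc f = D \<and> G = genus D f)"

definition Psi :: "nat \<Rightarrow> form \<Rightarrow> form set set" where
  "Psi p f = (case f of (a,b,c) \<Rightarrow>
     {cls g | g. primitive g \<and>
        (g = (a, b*int p, c*int p^2) \<or>
         (\<exists>h\<in>{0..<int p}. g = (a*int p^2, int p*(b+2*a*h), a*h^2+b*h+c)))})"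

text \<open>n-th coefficient of the theta series of a form.\<close>
definition theta :: "form \<Rightarrow> nat \<Rightarrow> real" where
  "theta f n = real (card {xy::int\<times>int. fval f (fst xy) (snd xy) = int n})"

definition theta_cls :: "form set \<Rightarrow> nat \<Rightarrow> real" where
  "theta_cls C n = theta (SOME f. f \<in> C) n"

text \<open>n-th coefficient of the series with q replaced by q^k.\<close>
definition theta_pow :: "form \<Rightarrow> nat \<Rightarrow> nat \<Rightarrow> real" where
  "theta_pow f k n = (if k dvd n then theta f (n div k) else 0)"

definition Pop :: "nat \<Rightarrow> nat \<Rightarrow> form \<Rightarrow> nat \<Rightarrow> real" where
  "Pop m r f n = (if n mod m = r then theta f n else 0)"

definition wD :: "int \<Rightarrow> real" where
  "wD D = (if D = -3 then 3 else if D = -4 then 2 else 1)"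

definition represents :: "form \<Rightarrow> int \<Rightarrow> bool" where
  "represents f r = (\<exists>x y. fval f x y = r)"

end

theory Submission
  imports Defs
begin

text \<open>The \<open>p + 1\<close> forms in the list defining \<open>\<Psi>\<^sub>p\<close> are the restrictions of
  \<open>f = (a,b,c)\<close> to the sublattices \<open>L\<close> of index \<open>p\<close> in \<open>\<int>\<^sup>2\<close>. Such a restriction is primitive
  iff \<open>f\<close> is prime to \<open>p\<close> on \<open>L - p\<int>\<^sup>2\<close>, and a vector outside \<open>p\<int>\<^sup>2\<close> lies in exactly
  one \<open>L\<close>. Proper equivalences between primitive restrictions extend to automorphs of \<open>f\<close>, and the
  automorphs modulo \<open>\<plusminus>1\<close> permute the sublattices with primitive restriction freely, so each class of
  \<open>\<Psi>\<^sub>p\<close> comes from exactly \<open>w\<close> sublattices. It remains to decide when the sublattices through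
  two vectors \<open>v\<close>, \<open>v'\<close> lie in one genus. The values prime to \<open>p\<close> on one \<open>L\<close> agree modulo squares
  (modulo \<open>2\<^sup>t\<^sup>+\<^sup>1\<close> for \<open>p = 2\<close>), which gives the necessary condition; conversely an element of the
  quadratic order whose norm is a square prime to \<open>2\<Delta>p\<^sup>2\<close> and which carries the line of \<open>v'\<close> modulo
  \<open>p\<close> to that of \<open>v\<close> yields, after division by the root of its norm, a rational equivalence.\<close>

section \<open>Forms, classes and genera\<close>

definition scale_form :: "int \<Rightarrow> form \<Rightarrow> form" where
  "scale_form k f = (case f of (a,b,c) \<Rightarrow> (k*a, k*b, k*c))"

lemma fval_transf:
  "fval (transf f al be ga de) x y = fval f (al*x + be*y) (ga*x + de*y)"
  by (cases f) (simp add: fval_def transf_def algebra_simps power2_eq_square)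

lemma fval_scale_form: "fval (scale_form k f) x y = k * fval f x y"
  by (cases f) (simp add: fval_def scale_form_def algebra_simps)

lemma transf_transf:
  fixes f :: "'a::comm_ring_1 \<times> 'a \<times> 'a"
  shows "transf (transf f al be ga de) al' be' ga' de' =
    transf f (al*al' + be*ga') (al*be' + be*de') (ga*al' + de*ga') (ga*be' + de*de')"
  by (cases f) (simp add: transf_def algebra_simps power2_eq_square)

lemma transf_scale_form:
  "transf (scale_form k f) al be ga de = scale_form k (transf f al be ga de)"
  by (cases f) (simp add: transf_def scale_form_def algebra_simps)

lemma transf_diag: "transf f k 0 0 k = scale_form (k^2) f"
  by (cases f) (simp add: transf_def scale_form_def algebra_simps power2_eq_square)

lemma scale_form_1 [simp]: "scale_form 1 f = f"
  by (cases f) (simp add: scale_form_def)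

lemma scale_form_scale_form: "scale_form k (scale_form l f) = scale_form (k*l) f"
  by (cases f) (simp add: scale_form_def)

lemma scale_form_cancel: "k \<noteq> 0 \<Longrightarrow> scale_form k f = scale_form k g \<longleftrightarrow> f = g"
  by (cases f; cases g) (simp add: scale_form_def)

lemma disc_transf: "disc (transf f al be ga de) = (al*de - be*ga)^2 * disc f"
  by (cases f) (simp add: disc_def transf_def algebra_simps power2_eq_square)

lemma form_eqI:
  assumes "\<And>x y. fval f x y = fval g x y"
  shows "f = g"
  using assms[of 1 0] assms[of 0 1] assms[of 1 1]
  by (cases f; cases g) (simp add: fval_def)

lemma sl2_equiv_refl: "sl2_equiv f f"
  unfolding sl2_equiv_def
  by (rule exI[of _ 1], rule exI[of _ 0], rule exI[of _ 0], rule exI[of _ 1])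
    (simp add: transf_diag)

lemma sl2_equiv_trans:
  assumes "sl2_equiv f g" "sl2_equiv g h"
  shows "sl2_equiv f h"
proof -
  obtain al be ga de where 1: "al*de - be*ga = (1::int)" "g = transf f al be ga de"
    using assms(1) unfolding sl2_equiv_def by blast
  obtain al' be' ga' de' where 2: "al'*de' - be'*ga' = (1::int)" "h = transf g al' be' ga' de'"
    using assms(2) unfolding sl2_equiv_def by blast
  have "(al*al' + be*ga') * (ga*be' + de*de') - (al*be' + be*de') * (ga*al' + de*ga')
      = (al*de - be*ga) * (al'*de' - be'*ga')"
    by (simp add: algebra_simps)
  then show ?thesis
    unfolding sl2_equiv_def using 1 2 transf_transf by (metis mult_1)
qed

lemma sl2_equiv_sym:
  assumes "sl2_equiv f g"
  shows "sl2_equiv g f"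
proof -
  obtain al be ga de where 1: "al*de - be*ga = (1::int)" "g = transf f al be ga de"
    using assms unfolding sl2_equiv_def by blast
  have "transf g de (-be) (-ga) al = transf f (al*de - be*ga) 0 0 (al*de - be*ga)"
    by (simp add: 1(2) transf_transf algebra_simps)
  then have "f = transf g de (-be) (-ga) al"
    using 1(1) transf_diag[of f 1] by simp
  moreover have "de*al - (-be)*(-ga) = 1" using 1(1) by (simp add: algebra_simps)
  ultimately show ?thesis unfolding sl2_equiv_def by blast
qed

lemma cls_eq_iff: "cls f = cls g \<longleftrightarrow> sl2_equiv f g"
proof
  assume "cls f = cls g"
  then have "f \<in> cls g" using sl2_equiv_refl[of f] unfolding cls_def by blast
  then show "sl2_equiv f g" unfolding cls_def by (simp add: sl2_equiv_sym)
next
  assume fg: "sl2_equiv f g"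
  show "cls f = cls g"
    unfolding cls_def
    using sl2_equiv_trans[OF fg] sl2_equiv_trans[OF sl2_equiv_sym[OF fg]] by blast
qed

lemma theta_sl2_equiv:
  assumes "sl2_equiv f g"
  shows "theta g n = theta f n"
proof -
  obtain al be ga de where 1: "al*de - be*ga = (1::int)" "g = transf f al be ga de"
    using assms unfolding sl2_equiv_def by blast
  have i: "de*(al*x + be*y) - be*(ga*x + de*y) = x" "al*(ga*x + de*y) - ga*(al*x + be*y) = y"
    "al*(de*x - be*y) + be*(al*y - ga*x) = x" "ga*(de*x - be*y) + de*(al*y - ga*x) = y" for x y
  proof -
    have "de*(al*x + be*y) - be*(ga*x + de*y) = (al*de - be*ga)*x"
      "al*(ga*x + de*y) - ga*(al*x + be*y) = (al*de - be*ga)*y"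
      "al*(de*x - be*y) + be*(al*y - ga*x) = (al*de - be*ga)*x"
      "ga*(de*x - be*y) + de*(al*y - ga*x) = (al*de - be*ga)*y"
      by (simp_all add: algebra_simps)
    then show "de*(al*x + be*y) - be*(ga*x + de*y) = x" "al*(ga*x + de*y) - ga*(al*x + be*y) = y"
      "al*(de*x - be*y) + be*(al*y - ga*x) = x" "ga*(de*x - be*y) + de*(al*y - ga*x) = y"
      by (simp_all add: 1(1))
  qed
  have "bij_betw (\<lambda>(x,y). (al*x + be*y, ga*x + de*y))
      {xy. fval g (fst xy) (snd xy) = int n} {xy. fval f (fst xy) (snd xy) = int n}"
    by (rule bij_betw_byWitness[where f' = "\<lambda>(x,y). (de*x - be*y, al*y - ga*x)"])
      (auto simp: 1(2) fval_transf i)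
  then show ?thesis unfolding theta_def by (simp add: bij_betw_same_card)
qed

text \<open>Makes the choice of a representative inside \<open>theta_cls\<close> harmless.\<close>

lemma theta_cls_eq: "theta_cls (cls f) n = theta f n"
proof -
  have "(SOME g. g \<in> cls f) \<in> cls f"
    by (rule someI[of _ f]) (simp add: cls_def sl2_equiv_refl)
  then have "sl2_equiv f (SOME g. g \<in> cls f)" by (simp add: cls_def)
  from theta_sl2_equiv[OF this] show ?thesis unfolding theta_cls_def .
qed

section \<open>The genus relation in terms of integral matrices\<close>

lemma coprime_denominator_Fract:
  assumes "coprime z N" "z \<noteq> 0"
  shows "coprime (snd (quotient_of (of_int x / of_int z))) N"
proof -
  obtain m n where mn: "quotient_of (of_int x / of_int z) = (m, n)" by force
  have n: "n > 0" and cop: "coprime m n"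
    using quotient_of_denom_pos[OF mn] quotient_of_coprime[OF mn] by auto
  have "of_int x / of_int z = (of_int m / of_int n :: rat)"
    using quotient_of_div[OF mn] by simp
  then have "(of_int (x * n) :: rat) = of_int (m * z)"
    using n assms(2) by (simp add: field_simps)
  then have "x * n = m * z" by (simp only: of_int_eq_iff)
  \<comment> \<open>Hence the reduced denominator divides z and inherits its coprimality to
    N.\<close>
  then have "n dvd m * z" by (metis dvd_triv_right)
  then have "n dvd z" using cop
    by (metis coprime_commute coprime_dvd_mult_right_iff)
  from coprime_divisors[OF this dvd_refl assms(1)] show ?thesis by (simp add: mn)
qed

text \<open>Whatever D is, \<open>2*D\<close> is not a unit, so 0 is never coprime to it.\<close>

lemma coprime_double_nonzero:
  fixes z D :: int
  assumes "coprime z (2*D)"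
  shows "z \<noteq> 0"
proof
  assume "z = 0"
  then have "is_unit (2*D)" using assms by simp
  then have "2*D = 1 \<or> 2*D = -1" by (auto simp: zdvd1_eq)
  then show False by presburger
qed

text \<open>Clearing denominators turns the relation into one between integral matrices.\<close>

lemma genus_rel_iff:
  "genus_rel D f g \<longleftrightarrow> (\<exists>z al be ga de. coprime z (2*D) \<and> al*de - be*ga = z^2 \<and>
     transf f al be ga de = scale_form (z^2) g)"
proof
  assume "genus_rel D f g"
  then obtain al be ga de :: rat where det: "al*de - be*ga = 1"
    and cop: "\<forall>z\<in>{al,be,ga,de}. coprime (snd (quotient_of z)) (2*D)"
    and eq: "ratform g = transf (ratform f) al be ga de"
    unfolding genus_rel_def by blast
  have denom: "\<exists>m n. x = of_int m / of_int n \<and> n > 0 \<and> snd (quotient_of x) = n" for x :: rat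
    by (metis prod.collapse quotient_of_denom_pos quotient_of_div)
  obtain a1 a2 where a: "al = of_int a1 / of_int a2" "a2 > 0" "coprime a2 (2*D)"
    using denom[of al] cop by auto
  obtain b1 b2 where b: "be = of_int b1 / of_int b2" "b2 > 0" "coprime b2 (2*D)"
    using denom[of be] cop by auto
  obtain c1 c2 where c: "ga = of_int c1 / of_int c2" "c2 > 0" "coprime c2 (2*D)"
    using denom[of ga] cop by auto
  obtain d1 d2 where d: "de = of_int d1 / of_int d2" "d2 > 0" "coprime d2 (2*D)"
    using denom[of de] cop by auto
  define z where "z = a2*b2*c2*d2"
  have z: "coprime z (2*D)" using a b c d by (simp add: z_def)
  define A B C E where "A = a1*b2*c2*d2" and "B = b1*a2*c2*d2" and "C = c1*a2*b2*d2"
    and "E = d1*a2*b2*c2"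
  have A: "of_int A = al * of_int z" and B: "of_int B = be * of_int z"
    and C: "of_int C = ga * of_int z" and E: "of_int E = de * of_int z"
    using a b c d by (auto simp: A_def B_def C_def E_def z_def)
  have "of_int (A*E - B*C) = (al*de - be*ga) * (of_int z)^2"
    by (simp add: A B C E algebra_simps power2_eq_square)
  then have "(of_int (A*E - B*C) :: rat) = of_int (z^2)" by (simp add: det)
  then have 1: "A*E - B*C = z^2" by (simp only: of_int_eq_iff)
  have "transf f A B C E = scale_form (z^2) g"
  proof -
    obtain x y w where f: "f = (x,y,w)" by (cases f)
    obtain x' y' w' where g: "g = (x',y',w')" by (cases g)
    have e: "of_int x' = of_int x * al^2 + of_int y * al*ga + of_int w * ga^2"
      "of_int y' = 2 * of_int x * al * be + of_int y*(al*de + be*ga) + 2 * of_int w * ga * de"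
      "of_int w' = of_int x * be^2 + of_int y * be*de + of_int w * de^2"
      using eq by (auto simp: f g ratform_def transf_def)
    have "(of_int (x*A^2 + y*A*C + w*C^2) :: rat) = of_int (z^2*x')"
      "(of_int (2*x*A*B + y*(A*E + B*C) + 2*w*C*E) :: rat) = of_int (z^2*y')"
      "(of_int (x*B^2 + y*B*E + w*E^2) :: rat) = of_int (z^2*w')"
      by (simp_all add: A B C E e algebra_simps power2_eq_square)
    then show ?thesis by (simp only: of_int_eq_iff f g transf_def scale_form_def prod.case)
  qed
  with 1 z show "\<exists>z al be ga de. coprime z (2*D) \<and> al*de - be*ga = z^2 \<and>
     transf f al be ga de = scale_form (z^2) g" by blast
next
  assume "\<exists>z al be ga de. coprime z (2*D) \<and> al*de - be*ga = z^2 \<and>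
     transf f al be ga de = scale_form (z^2) g"
  then obtain z A B C E where z: "coprime z (2*D)" and det: "A*E - B*C = z^2"
    and eq: "transf f A B C E = scale_form (z^2) g" by blast
  have z0: "z \<noteq> 0" using coprime_double_nonzero[OF z] .
  define Z :: rat where "Z = of_int z"
  have Z0: "Z \<noteq> 0" using z0 by (simp add: Z_def)
  have "of_int (A*E - B*C) = Z^2" by (simp add: det Z_def)
  then have det': "(of_int A / Z) * (of_int E / Z) - (of_int B / Z) * (of_int C / Z) = 1"
    using Z0 by (simp add: field_simps power2_eq_square)
  obtain x y w where f: "f = (x,y,w)" by (cases f)
  obtain x' y' w' where g: "g = (x',y',w')" by (cases g)
  have "x*A^2 + y*A*C + w*C^2 = z^2*x'"
    "2*x*A*B + y*(A*E + B*C) + 2*w*C*E = z^2*y'"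
    "x*B^2 + y*B*E + w*E^2 = z^2*w'"
    using eq by (auto simp: f g transf_def scale_form_def)
  then have "(of_int (x*A^2 + y*A*C + w*C^2) :: rat) = of_int (z^2*x')"
    "(of_int (2*x*A*B + y*(A*E + B*C) + 2*w*C*E) :: rat) = of_int (z^2*y')"
    "(of_int (x*B^2 + y*B*E + w*E^2) :: rat) = of_int (z^2*w')"
    by (simp_all only:)
  then have eq': "ratform g
      = transf (ratform f) (of_int A / Z) (of_int B / Z) (of_int C / Z) (of_int E / Z)"
    using Z0 by (simp add: f g ratform_def transf_def Z_def[symmetric] field_simps power2_eq_square)
  have cop: "\<forall>q\<in>{of_int A / Z, of_int B / Z, of_int C / Z, of_int E / Z}.
      coprime (snd (quotient_of q)) (2*D)"
    unfolding Z_def using coprime_denominator_Fract[OF z z0] by blast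
  show "genus_rel D f g"
    unfolding genus_rel_def by (intro exI) (rule conjI[OF det' conjI[OF cop eq']])
qed

lemma genus_rel_of_sl2_equiv: "sl2_equiv f g \<Longrightarrow> genus_rel D f g"
  unfolding genus_rel_iff sl2_equiv_def by (metis coprime_1_left one_power2 scale_form_1)

lemma genus_rel_trans:
  assumes "genus_rel D f g" "genus_rel D g h"
  shows "genus_rel D f h"
proof -
  obtain z al be ga de where 1: "coprime z (2*D)" "al*de - be*ga = z^2"
    "transf f al be ga de = scale_form (z^2) g"
    using assms(1) unfolding genus_rel_iff by blast
  obtain z' al' be' ga' de' where 2: "coprime z' (2*D)" "al'*de' - be'*ga' = z'^2"
    "transf g al' be' ga' de' = scale_form (z'^2) h"
    using assms(2) unfolding genus_rel_iff by blast
  have "transf f (al*al' + be*ga') (al*be' + be*de') (ga*al' + de*ga') (ga*be' + de*de')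
      = scale_form ((z*z')^2) h"
    by (simp add: transf_transf[symmetric] 1 2 transf_scale_form scale_form_scale_form
        power_mult_distrib)
  moreover have "(al*al' + be*ga') * (ga*be' + de*de') - (al*be' + be*de') * (ga*al' + de*ga')
      = (z*z')^2"
  proof -
    have "(al*al' + be*ga') * (ga*be' + de*de') - (al*be' + be*de') * (ga*al' + de*ga')
      = (al*de - be*ga) * (al'*de' - be'*ga')"
      by (simp add: algebra_simps)
    then show ?thesis by (simp add: 1 2 power_mult_distrib)
  qed
  moreover have "coprime (z*z') (2*D)" using 1 2 by simp
  ultimately show ?thesis unfolding genus_rel_iff by blast
qed

lemma genus_rel_sym:
  assumes "genus_rel D f g"
  shows "genus_rel D g f"
proof -
  obtain z al be ga de where 1: "coprime z (2*D)" "al*de - be*ga = z^2"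
    "transf f al be ga de = scale_form (z^2) g"
    using assms unfolding genus_rel_iff by blast
  have z0: "z \<noteq> 0" using coprime_double_nonzero[OF 1(1)] .
  \<comment> \<open>Substituting the adjugate matrix returns f times \<open>z^4\<close>; one factor
    \<open>z^2\<close> cancels against the one carried by g.\<close>
  have "scale_form (z^2) (transf g de (-be) (-ga) al)
      = transf f (al*de - be*ga) 0 0 (al*de - be*ga)"
    by (simp add: transf_scale_form[symmetric] 1(3)[symmetric] transf_transf algebra_simps)
  also have "\<dots> = scale_form (z^2) (scale_form (z^2) f)"
    by (simp add: 1(2) transf_diag scale_form_scale_form power2_eq_square)
  finally have "transf g de (-be) (-ga) al = scale_form (z^2) f"
    using z0 by (simp add: scale_form_cancel)
  moreover have "de*al - (-be)*(-ga) = z^2" using 1(2) by (simp add: algebra_simps)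
  ultimately show ?thesis unfolding genus_rel_iff using 1(1) by blast
qed

text \<open>The representative does not matter, because proper equivalence is the case z = 1 of the
  genus relation and the latter is transitive.\<close>

lemma cls_in_genus_iff:
  assumes "primitive g" "posdef g" "disc g = D"
  shows "cls g \<in> genus D f \<longleftrightarrow> genus_rel D f g"
proof
  assume "cls g \<in> genus D f"
  then obtain g' where "cls g = cls g'" "genus_rel D f g'"
    unfolding genus_def by blast
  then show "genus_rel D f g"
    using cls_eq_iff genus_rel_of_sl2_equiv genus_rel_trans by metis
next
  assume "genus_rel D f g"
  then show "cls g \<in> genus D f" unfolding genus_def using assms by blast
qed

text \<open>An integral automorph of a primitive form comes from a unit of norm 1 of the
  quadratic order.\<close>

lemma automorph_form:
  fixes a b c :: int
  assumes prim: "primitive (a,b,c)" and det: "al*de - be*ga = 1"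
    and eq: "transf (a,b,c) al be ga de = (a,b,c)"
  shows "\<exists>s u. s^2 - b*s*u + a*c*u^2 = 1 \<and> al = s - b*u \<and> be = -(c*u) \<and> ga = a*u \<and> de = s"
proof -
  have e: "a*al^2 + b*al*ga + c*ga^2 = a"
    "2*a*al*be + b*(al*de + be*ga) + 2*c*ga*de = b"
    "a*be^2 + b*be*de + c*de^2 = c"
    using eq by (auto simp: transf_def)
  \<comment> \<open>Multiplying the matrix equation M^T Q M = Q by the adjugate of M^T makes the
    conditions linear: (ga, de - al, -be) is proportional to (a, b, c).\<close>
  have "(al*de - be*ga) * (2*a*be + b*de)
      = de * (2*a*al*be + b*(al*de + be*ga) + 2*c*ga*de) - 2*ga * (a*be^2 + b*be*de + c*de^2)"
    "(al*de - be*ga) * (2*a*al + b*ga)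
      = 2*de * (a*al^2 + b*al*ga + c*ga^2) - ga * (2*a*al*be + b*(al*de + be*ga) + 2*c*ga*de)"
    "(al*de - be*ga) * (b*be + 2*c*de)
      = 2*al * (a*be^2 + b*be*de + c*de^2) - be * (2*a*al*be + b*(al*de + be*ga) + 2*c*ga*de)"
    by (simp_all add: algebra_simps power2_eq_square)
  then have ab: "a*be = -(c*ga)" and ad: "a*(de - al) = b*ga" and cd: "c*(de - al) = -(b*be)"
    unfolding det e by (simp_all add: algebra_simps)
  obtain x y z where bez: "x*a + y*b + z*c = 1"
  proof -
    obtain u v where uv: "u*a + v*gcd b c = gcd a (gcd b c)" using bezout_int by blast
    obtain u' v' where uv': "u'*b + v'*c = gcd b c" using bezout_int by blast
    have "u*a + (v*u')*b + (v*v')*c = 1"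
      using uv prim by (simp add: uv'[symmetric] primitive_def algebra_simps)
    then show ?thesis using that by blast
  qed
  \<comment> \<open>The factor of proportionality; the Bezout relation for the primitive triple (a,
    b, c) makes it an integer.\<close>
  define u where "u = x*ga + y*(de - al) - z*be"
  have "a*u = x*(a*ga) + y*(a*(de - al)) - z*(a*be)"
    by (simp add: u_def algebra_simps)
  also have "\<dots> = (x*a + y*b + z*c)*ga" unfolding ab ad by (simp add: algebra_simps)
  finally have au: "a*u = ga" by (simp add: bez)
  have bb: "b*be = -(c*(de - al))" by (simp only: cd minus_minus)
  have "b*u = x*(b*ga) + y*(b*(de - al)) - z*(b*be)"
    by (simp add: u_def algebra_simps)
  also have "\<dots> = (x*a + y*b + z*c)*(de - al)"
    unfolding ad[symmetric] bb by (simp add: algebra_simps)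
  finally have bu: "b*u = de - al" by (simp add: bez)
  have "c*u = x*(c*ga) + y*(c*(de - al)) - z*(c*be)"
    by (simp add: u_def algebra_simps)
  also have "\<dots> = x*(-(a*be)) + y*(-(b*be)) - z*(c*be)" unfolding cd ab by simp
  also have "\<dots> = -((x*a + y*b + z*c)*be)" by (simp add: algebra_simps)
  finally have cu: "c*u = -be" by (simp add: bez)
  have eqs: "al = de - b*u" "be = -(c*u)" "ga = a*u"
    by (simp_all add: au bu cu)
  moreover have "de^2 - b*de*u + a*c*u^2 = 1"
    using det unfolding eqs by (simp add: algebra_simps power2_eq_square)
  ultimately show ?thesis by blast
qed

section \<open>Sublattices of prime index\<close>

locale sublattice_forms =
  fixes a b c :: int and p :: nat
  assumes prim: "primitive (a,b,c)" and apos: "a > 0" and dneg: "b^2 - 4*a*c < 0"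
    and pp: "prime p"
begin

abbreviation P :: int where "P \<equiv> int p"
abbreviation \<Delta> :: int where "\<Delta> \<equiv> b^2 - 4*a*c"
abbreviation F :: "int \<Rightarrow> int \<Rightarrow> int" where "F \<equiv> fval (a,b,c)"

lemma prime_P: "prime P" using pp by simp

lemma P_gt_1: "P > 1" using pp prime_gt_1_nat by force

text \<open>The sublattices of index \<open>p\<close> are the preimages of the lines of \<open>\<F>\<^sub>p\<^sup>2\<close>. Index \<open>h < p\<close>
  stands for the line through \<open>(h, 1)\<close> and \<open>h = p\<close> for the one through \<open>(1, 0)\<close>.\<close>

definition vx :: "int \<Rightarrow> int" where "vx h = (if h = P then 1 else h)"
definition vy :: "int \<Rightarrow> int" where "vy h = (if h = P then 0 else 1)"

definition inlat :: "int \<Rightarrow> int \<Rightarrow> int \<Rightarrow> bool" where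
  "inlat h x y \<longleftrightarrow> P dvd vx h * y - vy h * x"

text \<open>The columns \<open>(m11, 0)\<close> and \<open>(m12, m22)\<close> form a triangular
  basis of the sublattice, chosen so that the restricted forms come out exactly as in the list
  defining \<open>Psi\<close>.\<close>

definition m11 :: "int \<Rightarrow> int" where "m11 h = (if h = P then 1 else P)"
definition m12 :: "int \<Rightarrow> int" where "m12 h = (if h = P then 0 else h)"
definition m22 :: "int \<Rightarrow> int" where "m22 h = (if h = P then P else 1)"

definition sub :: "int \<Rightarrow> form" where
  "sub h = transf (a,b,c) (m11 h) (m12 h) 0 (m22 h)"

definition good :: "int \<Rightarrow> bool" where "good h \<longleftrightarrow> \<not> P dvd F (vx h) (vy h)"

lemma det_basis: "m11 h * m22 h = P"
  by (simp add: m11_def m22_def)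

lemma sub_explicit:
  "sub h = (if h = P then (a, b*P, c*P^2) else (a*P^2, P*(b + 2*a*h), a*h^2 + b*h + c))"
  by (simp add: sub_def transf_def m11_def m12_def m22_def algebra_simps)

lemma disc_sub: "disc (sub h) = \<Delta> * P^2"
  unfolding sub_def disc_transf by (simp add: det_basis disc_def)

lemma posdef_sub: "posdef (sub h)"
proof -
  have "disc (sub h) < 0" unfolding disc_sub using dneg P_gt_1 by (simp add: mult_neg_pos)
  moreover have "fst (sub h) > 0" using apos P_gt_1 by (simp add: sub_explicit)
  ultimately show ?thesis by (cases "sub h") (simp add: posdef_def disc_def)
qed

lemma inlat_iff: "inlat h x y \<longleftrightarrow> (\<exists>X Y. x = m11 h * X + m12 h * Y \<and> y = m22 h * Y)"
proof (cases "h = P")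
  case True
  then show ?thesis by (auto simp: inlat_def vx_def vy_def m11_def m12_def m22_def dvd_def)
next
  case False
  have "P dvd h*y - x \<longleftrightarrow> (\<exists>X. x = P*X + h*y)"
  proof
    assume "P dvd h*y - x"
    then obtain k where "h*y - x = P*k" by blast
    then have "x = P*(-k) + h*y" by simp
    then show "\<exists>X. x = P*X + h*y" by blast
  qed auto
  with False show ?thesis by (auto simp: inlat_def vx_def vy_def m11_def m12_def m22_def)
qed

lemma fval_sub: "fval (sub h) X Y = F (m11 h * X + m12 h * Y) (m22 h * Y)"
  by (simp add: sub_def fval_transf)

lemma inlat_multiple: "P dvd x \<Longrightarrow> P dvd y \<Longrightarrow> inlat h x y"
  by (simp add: inlat_def)

lemma inlat_v: "inlat h (vx h) (vy h)"
  by (simp add: inlat_def)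

lemma inlat_det:
  assumes "inlat h x y" "inlat h x' y'"
  shows "P dvd x*y' - x'*y"
proof (cases "h = P")
  case True
  with assms show ?thesis by (simp add: inlat_def vx_def vy_def)
next
  case False
  with assms have "P dvd h*y - x" "P dvd h*y' - x'" by (auto simp: inlat_def vx_def vy_def)
  then have "P dvd y*(h*y' - x') - y'*(h*y - x)" by (simp only: dvd_diff dvd_mult)
  then show ?thesis by (simp add: algebra_simps)
qed

text \<open>A line modulo p is spanned by any nonzero vector on it, so vanishing of the determinant
  against one such vector suffices.\<close>

lemma inlat_of_det:
  assumes "inlat h x y" "\<not> (P dvd x \<and> P dvd y)" "P dvd x*y' - x'*y"
  shows "inlat h x' y'"
proof (cases "h = P")
  case True
  then have y: "P dvd y" using assms(1) by (simp add: inlat_def vx_def vy_def)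
  then have "P dvd x*y' - x'*y + x'*y" using assms(3) by (intro dvd_add dvd_mult)
  then have "P dvd y'" using y assms(2) prime_dvd_mult_iff[OF prime_P] by simp
  then show ?thesis using True by (simp add: inlat_def vx_def vy_def)
next
  case False
  then have h: "P dvd h*y - x" using assms(1) by (simp add: inlat_def vx_def vy_def)
  have "\<not> P dvd y"
  proof
    assume y: "P dvd y"
    then have "P dvd h*y - (h*y - x)" using h by (metis dvd_diff dvd_mult)
    then show False using y assms(2) by simp
  qed
  moreover have "P dvd y'*(h*y - x) + (x*y' - x'*y)" using h assms(3) by (intro dvd_add dvd_mult)
  then have "P dvd y*(h*y' - x')" by (simp add: algebra_simps)
  ultimately have "P dvd h*y' - x'" using prime_dvd_mult_iff[OF prime_P] by blast
  then show ?thesis using False by (simp add: inlat_def vx_def vy_def)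
qed

text \<open>Distinct lines modulo p meet only in 0. For two indices below p, a common vector gives p
  | h - j with |h - j| < p.\<close>

lemma inlat_unique:
  assumes "h \<in> {0..P}" "j \<in> {0..P}" "inlat h x y" "inlat j x y" "\<not> (P dvd x \<and> P dvd y)"
  shows "h = j"
proof -
  have aux: False if "i \<noteq> P" "inlat P x y" "inlat i x y" for i
  proof -
    have y: "P dvd y" "P dvd i*y - x" using that by (auto simp: inlat_def vx_def vy_def)
    then have "P dvd i*y - (i*y - x)" by (metis dvd_diff dvd_mult)
    then show False using y(1) assms(5) by simp
  qed
  show ?thesis
  proof (cases "h = P \<or> j = P")
    case True
    then show ?thesis using aux assms(3,4) by metis
  next
    case False
    then have hj: "P dvd h*y - x" "P dvd j*y - x" using assms by (auto simp: inlat_def vx_def vy_def)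
    have "\<not> P dvd y"
    proof
      assume y: "P dvd y"
      then have "P dvd h*y - (h*y - x)" using hj by (metis dvd_diff dvd_mult)
      then show False using y assms(5) by simp
    qed
    moreover have "P dvd (h*y - x) - (j*y - x)" using hj by (rule dvd_diff)
    then have "P dvd (h - j)*y" by (simp add: algebra_simps)
    ultimately have "P dvd h - j" using prime_dvd_mult_iff[OF prime_P] by blast
    moreover have "h \<in> {0..<P}" "j \<in> {0..<P}" using False assms(1,2) by auto
    ultimately show ?thesis using zdvd_imp_le[of P "h - j"] zdvd_imp_le[of P "j - h"]
      by (cases h j rule: linorder_cases) (auto simp: dvd_diff_commute)
  qed
qed

lemma inlat_exists:
  assumes "\<not> (P dvd x \<and> P dvd y)"
  shows "\<exists>h\<in>{0..P}. inlat h x y"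
proof (cases "P dvd y")
  case True
  then have "inlat P x y" by (simp add: inlat_def vx_def vy_def)
  then show ?thesis using P_gt_1 by force
next
  case False
  then have "coprime y P" using prime_imp_coprime[OF prime_P] coprime_commute by blast
  then obtain k where k: "[y * k = 1] (mod P)" using cong_solve_coprime_int by blast
  \<comment> \<open>As k inverts y, this is the quotient x/y modulo p.\<close>
  define h where "h = (x * k) mod P"
  have h: "0 \<le> h" "h < P" using P_gt_1 by (auto simp: h_def)
  have "[h * y = x * (y * k)] (mod P)" by (simp add: h_def cong_def mod_simps ac_simps)
  also have "[x * (y * k) = x * 1] (mod P)" using k by (rule cong_scalar_left)
  finally have "P dvd h*y - x" by (simp add: cong_iff_dvd_diff)
  then have "inlat h x y" using h by (simp add: inlat_def vx_def vy_def)
  then show ?thesis using h by force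
qed

lemma F_cong:
  assumes "[x = x'] (mod N)" "[y = y'] (mod N)"
  shows "[F x y = F x' y'] (mod N)"
  unfolding fval_def using assms by (simp add: cong_add cong_mult cong_pow)

text \<open>Modulo p the sublattice is the line through its direction vector, so all values of F on
  it lie in one class up to squares. This is the invariant of the genus for odd p.\<close>

lemma inlat_multiple_v:
  assumes "inlat h x y"
  shows "\<exists>l. [x = l * vx h] (mod P) \<and> [y = l * vy h] (mod P) \<and>
    [F x y = l^2 * F (vx h) (vy h)] (mod P)"
proof -
  define l where "l = (if h = P then x else y)"
  have 1: "[x = l * vx h] (mod P)" "[y = l * vy h] (mod P)"
    using assms
    by (auto simp: inlat_def vx_def vy_def l_def cong_iff_dvd_diff dvd_diff_commute algebra_simps)
  then have "[F x y = F (l * vx h) (l * vy h)] (mod P)" by (rule F_cong)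
  also have "F (l * vx h) (l * vy h) = l^2 * F (vx h) (vy h)"
    by (simp add: fval_def algebra_simps power2_eq_square)
  finally show ?thesis using 1 by blast
qed

text \<open>Modulo p the value is \<open>l^2\<close> times a unit, so p divides it only if p divides
  l.\<close>

lemma good_dvd:
  assumes "good h" "inlat h x y" "P dvd F x y"
  shows "P dvd x \<and> P dvd y"
proof -
  obtain l where l: "[x = l * vx h] (mod P)" "[y = l * vy h] (mod P)"
    "[F x y = l^2 * F (vx h) (vy h)] (mod P)"
    using inlat_multiple_v[OF assms(2)] by blast
  have "P dvd l^2 * F (vx h) (vy h)" using l(3) assms(3) cong_dvd_iff by blast
  then have "P dvd l"
    using assms(1) prime_dvd_mult_iff[OF prime_P] prime_dvd_power[OF prime_P] by (auto simp: good_def)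
  then show ?thesis using l(1,2) cong_dvd_iff by (metis dvd_mult2)
qed

lemma goodI:
  assumes "inlat h x y" "\<not> P dvd F x y"
  shows "good h"
  using inlat_multiple_v[OF assms(1)] assms(2) cong_dvd_iff unfolding good_def by (metis dvd_mult)

lemma F_scale: "F (l * x) (l * y) = l^2 * F x y"
  by (simp add: fval_def algebra_simps power2_eq_square)

lemma F_multiple: "P dvd x \<Longrightarrow> P dvd y \<Longrightarrow> P^2 dvd F x y"
  using F_scale by fastforce

lemma not_dvd_F: "\<not> P dvd F x y \<Longrightarrow> \<not> (P dvd x \<and> P dvd y)"
  using F_multiple by (metis dvd_mult_left power2_eq_square)

text \<open>One outer coefficient of the restriction is the value of F at the direction vector and
  the other two are multiples of p, which settles the prime p. The basis has determinant p, so any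
  other prime dividing the restriction would divide a, b and c.\<close>

lemma primitive_sub_iff: "primitive (sub h) \<longleftrightarrow> good h"
proof
  assume pr: "primitive (sub h)"
  show "good h"
    unfolding good_def
  proof
    assume d: "P dvd F (vx h) (vy h)"
    obtain A B C where s: "sub h = (A,B,C)" by (cases "sub h")
    have "P dvd A \<and> P dvd B \<and> P dvd C"
      using d s by (cases "h = P") (auto simp: sub_explicit vx_def vy_def fval_def power2_eq_square)
    then have "P dvd gcd A (gcd B C)" by (simp only: gcd_greatest_iff)
    moreover have "gcd A (gcd B C) = 1" using pr s by (simp add: primitive_def)
    ultimately have "P dvd 1" by (simp only:)
    then show False using P_gt_1 by simp
  qed
next
  assume g: "good h"
  obtain A B C where s: "sub h = (A,B,C)" by (cases "sub h")
  show "primitive (sub h)"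
  proof (rule ccontr)
    assume "\<not> primitive (sub h)"
    then have "\<not> is_unit (gcd A (gcd B C))" by (simp add: s primitive_def)
    moreover have "gcd A (gcd B C) \<noteq> 0"
      using posdef_sub[of h] by (auto simp: s posdef_def)
    ultimately obtain q where q: "prime q" "q dvd gcd A (gcd B C)"
      using prime_divisorE by blast
    then have qd: "q dvd A" "q dvd B" "q dvd C" by auto
    have qP: "q \<noteq> P"
      using g qd s by (cases "h = P") (auto simp: good_def sub_explicit vx_def vy_def fval_def)
    then have nd: "\<not> q dvd P" using q(1) prime_P primes_dvd_imp_eq by blast
    note pm = prime_dvd_mult_iff[OF q(1)]
    have "q dvd a \<and> q dvd b \<and> q dvd c"
    proof (cases "h = P")
      case True
      then show ?thesis using qd s nd pm by (auto simp: sub_explicit power2_eq_square)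
    next
      case False
      then have 1: "q dvd a" "q dvd b + 2*a*h" "q dvd a*h^2 + b*h + c"
        using qd s nd pm by (auto simp: sub_explicit power2_eq_square)
      then have 2: "q dvd b" by (metis dvd_add_left_iff dvd_mult dvd_mult2)
      then have "q dvd c" using 1 by (metis dvd_add_right_iff dvd_add dvd_mult2)
      with 1 2 show ?thesis by blast
    qed
    then have "q dvd gcd a (gcd b c)" by (simp only: gcd_greatest_iff)
    moreover have "gcd a (gcd b c) = 1" using prim by (simp add: primitive_def)
    ultimately have "q dvd 1" by (simp only:)
    then show False using q(1) not_prime_unit by blast
  qed
qed

end

section \<open>Equivalence of restrictions\<close>

context sublattice_forms begin

text \<open>The element \<open>s + u\<omega>\<close> of the quadratic order, \<open>\<omega> = (-b + \<surd>\<Delta>)/2\<close>, acts on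
  \<open>\<int>\<^sup>2\<close> by the matrix with rows \<open>(s - bu, -cu)\<close> and \<open>(au, s)\<close>, which multiplies \<open>F\<close> by
  the norm \<open>s\<^sup>2 - bsu + acu\<^sup>2\<close>.\<close>

definition nrm :: "int \<Rightarrow> int \<Rightarrow> int" where "nrm s u = s^2 - b*s*u + a*c*u^2"
definition ax :: "int \<Rightarrow> int \<Rightarrow> int \<Rightarrow> int \<Rightarrow> int" where "ax s u x y = (s - b*u)*x - c*u*y"
definition ay :: "int \<Rightarrow> int \<Rightarrow> int \<Rightarrow> int \<Rightarrow> int" where "ay s u x y = a*u*x + s*y"

lemma F_act: "F (ax s u x y) (ay s u x y) = nrm s u * F x y"
  by (simp add: fval_def ax_def ay_def nrm_def algebra_simps power2_eq_square)

lemma transf_act: "transf (a,b,c) (s - b*u) (-(c*u)) (a*u) s = scale_form (nrm s u) (a,b,c)"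
  by (simp add: transf_def scale_form_def nrm_def algebra_simps power2_eq_square)

text \<open>Modulo p the left side vanishes when the image of (x', y') is parallel to (x, y); the
  right side turns this into a linear condition on s and u.\<close>

lemma det_act:
  "x * ay s u x' y' - ax s u x' y' * y = s*(x*y' - x'*y) + u*(a*x*x' + b*x'*y + c*y*y')"
  by (simp add: ax_def ay_def algebra_simps)

text \<open>The divisibility places the image of one vector of h in j. That vector is an invertible
  multiple of the direction vector modulo p, so by linearity all of h is mapped into j.\<close>

lemma inlat_act:
  assumes "inlat j x y" "\<not> (P dvd x \<and> P dvd y)"
    and "inlat h x' y'" "\<not> (P dvd x' \<and> P dvd y')"
    and "P dvd s*(x*y' - x'*y) + u*(a*x*x' + b*x'*y + c*y*y')"
    and "inlat h X Y"
  shows "inlat j (ax s u X Y) (ay s u X Y)"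
proof -
  have 1: "inlat j (ax s u x' y') (ay s u x' y')"
    by (rule inlat_of_det[OF assms(1,2)]) (simp add: det_act assms(5))
  obtain l where l: "[x' = l * vx h] (mod P)" "[y' = l * vy h] (mod P)"
    using inlat_multiple_v[OF assms(3)] by blast
  obtain k where k: "[X = k * vx h] (mod P)" "[Y = k * vy h] (mod P)"
    using inlat_multiple_v[OF assms(6)] by blast
  have nl: "\<not> P dvd l"
  proof
    assume "P dvd l"
    then have "P dvd l * vx h" "P dvd l * vy h" by auto
    then show False using l assms(4) cong_dvd_iff by blast
  qed
  have "[vx j * ay s u x' y' - vy j * ax s u x' y'
      = vx j * ay s u (l * vx h) (l * vy h) - vy j * ax s u (l * vx h) (l * vy h)] (mod P)"
    unfolding ax_def ay_def using l by (intro cong_diff cong_add cong_mult cong_refl)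
  then have "P dvd vx j * ay s u (l * vx h) (l * vy h) - vy j * ax s u (l * vx h) (l * vy h)"
    using 1 cong_dvd_iff unfolding inlat_def by blast
  then have "P dvd l * (vx j * ay s u (vx h) (vy h) - vy j * ax s u (vx h) (vy h))"
    by (simp add: ax_def ay_def algebra_simps)
  then have "P dvd vx j * ay s u (vx h) (vy h) - vy j * ax s u (vx h) (vy h)"
    using nl prime_dvd_mult_iff[OF prime_P] by blast
  then have "P dvd k * (vx j * ay s u (vx h) (vy h) - vy j * ax s u (vx h) (vy h))" by simp
  moreover have "[vx j * ay s u X Y - vy j * ax s u X Y
      = vx j * ay s u (k * vx h) (k * vy h) - vy j * ax s u (k * vx h) (k * vy h)] (mod P)"
    unfolding ax_def ay_def using k by (intro cong_diff cong_add cong_mult cong_refl)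
  moreover have "vx j * ay s u (k * vx h) (k * vy h) - vy j * ax s u (k * vx h) (k * vy h)
    = k * (vx j * ay s u (vx h) (vy h) - vy j * ax s u (vx h) (vy h))"
    by (simp add: ax_def ay_def algebra_simps)
  ultimately show ?thesis unfolding inlat_def using cong_dvd_iff by metis
qed

text \<open>In the bases of the two sublattices the action becomes an integral matrix, and the two
  basis determinants p cancel. Norm 1 will give proper equivalences, square norms rational
  ones.\<close>

lemma similitude_sub:
  assumes "inlat j x y" "\<not> (P dvd x \<and> P dvd y)"
    and "inlat h x' y'" "\<not> (P dvd x' \<and> P dvd y')"
    and "P dvd s*(x*y' - x'*y) + u*(a*x*x' + b*x'*y + c*y*y')"
  shows "\<exists>al be ga de. al*de - be*ga = nrm s u \<and>
    transf (sub j) al be ga de = scale_form (nrm s u) (sub h)"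
proof -
  have "inlat h (m11 h) 0" 
    unfolding inlat_iff by (rule exI[of _ 1], rule exI[of _ 0]) simp
  from inlat_act[OF assms this] obtain al ga where
    1: "ax s u (m11 h) 0 = m11 j * al + m12 j * ga" "ay s u (m11 h) 0 = m22 j * ga"
    unfolding inlat_iff by blast
  have "inlat h (m12 h) (m22 h)"
    unfolding inlat_iff by (rule exI[of _ 0], rule exI[of _ 1]) simp
  from inlat_act[OF assms this] obtain be de where
    2: "ax s u (m12 h) (m22 h) = m11 j * be + m12 j * de" "ay s u (m12 h) (m22 h) = m22 j * de"
    unfolding inlat_iff by blast
  have "P * (al*de - be*ga) = (m11 j * al + m12 j * ga) * (m22 j * de)
      - (m11 j * be + m12 j * de) * (m22 j * ga)"
    by (simp add: det_basis[of j, symmetric] algebra_simps)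
  also have "\<dots> = ax s u (m11 h) 0 * ay s u (m12 h) (m22 h)
      - ax s u (m12 h) (m22 h) * ay s u (m11 h) 0"
    by (simp only: 1 2)
  also have "\<dots> = P * nrm s u"
    by (simp add: det_basis[of h, symmetric] ax_def ay_def nrm_def algebra_simps power2_eq_square)
  finally have det: "al*de - be*ga = nrm s u" using P_gt_1 by simp
  have "transf (sub j) al be ga de
      = transf (a,b,c) (m11 j * al + m12 j * ga) (m11 j * be + m12 j * de) (m22 j * ga) (m22 j * de)"
    by (simp add: sub_def transf_transf)
  also have "\<dots> = transf (a,b,c) (ax s u (m11 h) 0) (ax s u (m12 h) (m22 h))
      (ay s u (m11 h) 0) (ay s u (m12 h) (m22 h))"
    by (simp only: 1 2)
  also have "\<dots> = transf (transf (a,b,c) (s - b*u) (-(c*u)) (a*u) s) (m11 h) (m12 h) 0 (m22 h)"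
    by (simp add: transf_transf ax_def ay_def)
  also have "\<dots> = scale_form (nrm s u) (sub h)"
    by (simp add: transf_act transf_scale_form sub_def)
  finally show ?thesis using det by blast
qed

lemma sl2_equiv_sub_of_unit:
  assumes "nrm s u = 1" "good h" "inlat j (ax s u (vx h) (vy h)) (ay s u (vx h) (vy h))"
  shows "sl2_equiv (sub j) (sub h)"
proof -
  define x y where "x = ax s u (vx h) (vy h)" and "y = ay s u (vx h) (vy h)"
  have v: "\<not> (P dvd vx h \<and> P dvd vy h)" using assms(2) not_dvd_F unfolding good_def by blast
  have "F x y = F (vx h) (vy h)" by (simp add: x_def y_def F_act assms(1))
  then have xy: "\<not> (P dvd x \<and> P dvd y)" using assms(2) not_dvd_F unfolding good_def by metis
  \<comment> \<open>By \<open>det_act\<close> this is the determinant of (x, y) with itself.\<close>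
  have "s*(x*vy h - vx h*y) + u*(a*x*vx h + b*vx h*y + c*y*vy h) = 0"
    by (simp add: det_act[symmetric] x_def[symmetric] y_def[symmetric])
  then have d: "P dvd s*(x*vy h - vx h*y) + u*(a*x*vx h + b*vx h*y + c*y*vy h)" by simp
  from similitude_sub[OF assms(3)[folded x_def y_def] xy inlat_v v d] show ?thesis
    unfolding sl2_equiv_def assms(1) by (metis scale_form_1)
qed

text \<open>A proper equivalence between two restrictions extends to \<open>\<int>\<^sup>2\<close>: in a good sublattice the
  vectors of \<open>p\<int>\<^sup>2\<close> are exactly those on which \<open>F\<close> is divisible by \<open>p\<close>.\<close>

lemma unit_of_sl2_equiv_sub:
  assumes "good j" "sl2_equiv (sub j) (sub h)"
  shows "\<exists>s u. nrm s u = 1 \<and> inlat j (ax s u (vx h) (vy h)) (ay s u (vx h) (vy h))"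
proof -
  obtain q11 q12 q21 q22 where q: "q11*q22 - q12*q21 = (1::int)"
    "sub h = transf (sub j) q11 q12 q21 q22"
    using assms(2) unfolding sl2_equiv_def by blast
  \<comment> \<open>The matrix sending coordinates in the basis of h to vectors of the sublattice
    j.\<close>
  define x11 x12 x21 x22 where "x11 = m11 j * q11 + m12 j * q21"
    and "x12 = m11 j * q12 + m12 j * q22" and "x21 = m22 j * q21" and "x22 = m22 j * q22"
  have lat: "inlat j (x11*X + x12*Y) (x21*X + x22*Y)" for X Y
    unfolding inlat_iff x11_def x12_def x21_def x22_def
    by (rule exI[of _ "q11*X + q12*Y"], rule exI[of _ "q21*X + q22*Y"]) (simp add: algebra_simps)
  have eqF: "F (x11*X + x12*Y) (x21*X + x22*Y) = F (m11 h * X + m12 h * Y) (m22 h * Y)" for X Y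
  proof -
    have "fval (sub h) X Y = fval (sub j) (q11*X + q12*Y) (q21*X + q22*Y)"
      by (simp add: q(2) fval_transf)
    then show ?thesis
      by (simp add: fval_sub x11_def x12_def x21_def x22_def algebra_simps)
  qed
  \<comment> \<open>The extension to the whole plane lattice is this matrix times the inverse basis
    matrix of h. The adjugate has columns \<open>(m22, 0)\<close> and \<open>(- m12, m11)\<close>;
    their images have the values of F at p(1, 0) and p(0, 1), so \<open>good_dvd\<close> allows
    division by p.\<close>
  have "P dvd x11 * m22 h \<and> P dvd x21 * m22 h"
  proof (rule good_dvd[OF assms(1)])
    show "inlat j (x11 * m22 h) (x21 * m22 h)" using lat[of "m22 h" 0] by simp
    show "P dvd F (x11 * m22 h) (x21 * m22 h)"
      using eqF[of "m22 h" 0] by (simp add: det_basis fval_def)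
  qed
  then obtain al ga where c1: "x11 * m22 h = P * al" "x21 * m22 h = P * ga" by (auto elim!: dvdE)
  have "P dvd x11 * (- m12 h) + x12 * m11 h \<and> P dvd x21 * (- m12 h) + x22 * m11 h"
  proof (rule good_dvd[OF assms(1)])
    show "inlat j (x11 * (- m12 h) + x12 * m11 h) (x21 * (- m12 h) + x22 * m11 h)" using lat .
    have "m11 h * (- m12 h) + m12 h * m11 h = 0" "m22 h * m11 h = P"
      using det_basis[of h] by (simp_all add: algebra_simps)
    then show "P dvd F (x11 * (- m12 h) + x12 * m11 h) (x21 * (- m12 h) + x22 * m11 h)"
      unfolding eqF by (simp only: fval_def) (simp add: power2_eq_square)
  qed
  then obtain be de where c2: "x11 * (- m12 h) + x12 * m11 h = P * be"
    "x21 * (- m12 h) + x22 * m11 h = P * de" by (auto elim!: dvdE)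
  have P0: "P \<noteq> 0" using P_gt_1 by simp
  have M: "al * m11 h = x11" "ga * m11 h = x21" "al * m12 h + be * m22 h = x12"
    "ga * m12 h + de * m22 h = x22"
  proof -
    have "P * (al * m11 h) = P * x11" "P * (ga * m11 h) = P * x21"
      unfolding mult.assoc[symmetric] c1[symmetric]
      by (simp_all add: det_basis[of h, symmetric] algebra_simps)
    moreover have "P * (al * m12 h + be * m22 h) = P * x12" "P * (ga * m12 h + de * m22 h) = P * x22"
      unfolding distrib_left mult.assoc[symmetric] c1[symmetric] c2[symmetric]
      by (simp_all add: det_basis[of h, symmetric] algebra_simps)
    ultimately show "al * m11 h = x11" "ga * m11 h = x21" "al * m12 h + be * m22 h = x12"
      "ga * m12 h + de * m22 h = x22" using P0 by auto
  qed
  have "(al*de - be*ga) * (m11 h * m22 h) = x11*x22 - x12*x21"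
    by (simp add: M[symmetric] algebra_simps)
  also have "\<dots> = m11 j * m22 j * (q11*q22 - q12*q21)"
    by (simp add: x11_def x12_def x21_def x22_def algebra_simps)
  finally have det: "al*de - be*ga = 1" using P0 q(1) by (simp add: det_basis)
  have "transf (a,b,c) al be ga de = (a,b,c)"
  proof (rule form_eqI)
    fix x y
    have "P * (al*x + be*y) = x11*(m22 h * x - m12 h * y) + x12*(m11 h * y)"
      "P * (ga*x + de*y) = x21*(m22 h * x - m12 h * y) + x22*(m11 h * y)"
      unfolding distrib_left mult.assoc[symmetric] c1[symmetric] c2[symmetric]
      by (simp_all add: algebra_simps)
    then have "P^2 * F (al*x + be*y) (ga*x + de*y)
        = F (m11 h * (m22 h * x - m12 h * y) + m12 h * (m11 h * y)) (m22 h * (m11 h * y))"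
      by (simp only: F_scale[symmetric] eqF)
    also have "\<dots> = F (m11 h * m22 h * x) (m11 h * m22 h * y)" by (simp add: algebra_simps)
    also have "\<dots> = P^2 * F x y" by (simp only: F_scale det_basis)
    finally show "fval (transf (a,b,c) al be ga de) x y = F x y" using P0 by (simp add: fval_transf)
  qed
  from automorph_form[OF prim det this] obtain s u where su: "nrm s u = 1"
    "al = s - b*u" "be = -(c*u)" "ga = a*u" "de = s" unfolding nrm_def by blast
  obtain X Y where v: "vx h = m11 h * X + m12 h * Y" "vy h = m22 h * Y"
    using inlat_v inlat_iff by blast
  have "ax s u (vx h) (vy h) = x11*X + x12*Y" "ay s u (vx h) (vy h) = x21*X + x22*Y"
    unfolding M[symmetric] v su by (simp_all add: ax_def ay_def algebra_simps)
  then show ?thesis using su(1) lat by metis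
qed

section \<open>Units of norm 1 up to sign, and the number w\<close>

definition half_units :: "(int \<times> int) set" where
  "half_units = {(s,u). nrm s u = 1 \<and> (u > 0 \<or> u = 0 \<and> s > 0)}"

lemma four_nrm: "4 * nrm s u = (2*s - b*u)^2 - \<Delta> * u^2"
  by (simp add: nrm_def algebra_simps power2_eq_square)

lemma disc_mod_4: "\<Delta> mod 4 = 0 \<or> \<Delta> mod 4 = 1"
proof -
  have "\<Delta> = b^2 + 4*(-(a*c))" by simp
  then have 1: "\<Delta> mod 4 = b^2 mod 4" by (simp only: mod_mult_self2)
  show ?thesis
  proof (cases "even b")
    case True
    then obtain k where "b = 2*k" by blast
    then have "b^2 = 4*k^2" by (simp add: power2_eq_square)
    then show ?thesis unfolding 1 by simp
  next
    case False
    then obtain k where "b = 2*k + 1" by (blast elim: oddE)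
    then have "b^2 = 1 + 4*(k^2 + k)" by (simp add: power2_eq_square algebra_simps)
    then have "b^2 mod 4 = 1 mod 4" by (simp only: mod_mult_self2)
    then show ?thesis unfolding 1 by simp
  qed
qed

text \<open>By \<open>four_nrm\<close>, u >= 1 forces the discriminant to be at least -4; residues
  modulo 4 leave only -3 and -4, each with u = 1.\<close>

lemma half_units_cases:
  assumes "(s,u) \<in> half_units"
  shows "(s,u) = (1,0) \<or> \<Delta> = -4 \<and> u = 1 \<and> 2*s = b \<or>
    \<Delta> = -3 \<and> u = 1 \<and> (2*s = b + 1 \<or> 2*s = b - 1)"
proof (cases "u = 0")
  case True
  with assms have "s^2 = 1" "s > 0" by (auto simp: half_units_def nrm_def)
  then show ?thesis using True by (simp add: power2_eq_1_iff)
next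
  case False
  with assms have u: "u \<ge> 1" and eq: "(2*s - b*u)^2 - \<Delta> * u^2 = 4"
    by (auto simp: half_units_def four_nrm[symmetric])
  have u2: "u^2 \<ge> 1" using u by simp
  have sq: "(2*s - b*u)^2 \<ge> 0" by simp
  have "D \<ge> -4" if "S \<ge> 0" "U \<ge> 1" "D < 0" "S - D * U = 4" for S U D :: int
  proof -
    have "D * U \<le> D * 1" using that by (intro mult_left_mono_neg) auto
    then show ?thesis using that by linarith
  qed
  from this[OF sq u2 dneg eq] have "\<Delta> \<ge> -4" .
  then have D: "\<Delta> = -4 \<or> \<Delta> = -3"
    using dneg disc_mod_4 by presburger
  have "(2*s - b*u)^2 + 4*u^2 = 4 \<or> (2*s - b*u)^2 + 3*u^2 = 4" using D eq by auto
  then have "3 * u^2 \<le> 4" using sq u2 by linarith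
  then have "u^2 = 1" using u2 by linarith
  then have u1: "u = 1" using u by (simp add: power2_eq_1_iff)
  from D show ?thesis
  proof
    assume "\<Delta> = -4"
    then show ?thesis using eq u1 by simp
  next
    assume D3: "\<Delta> = -3"
    then have "(2*s - b)^2 = 1" using eq u1 by simp
    then have "2*s - b = 1 \<or> 2*s - b = -1" by (simp add: power2_eq_1_iff)
    then show ?thesis using D3 u1 by auto
  qed
qed

lemma half_units_eq:
  "\<Delta> = -4 \<Longrightarrow> half_units = {(1,0), (b div 2, 1)}"
  "\<Delta> = -3 \<Longrightarrow> half_units = {(1,0), ((b + 1) div 2, 1), ((b - 1) div 2, 1)}"
  "\<Delta> < -4 \<Longrightarrow> half_units = {(1,0)}"
proof -
  have 1: "(1,0) \<in> half_units" by (simp add: half_units_def nrm_def)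
  show "half_units = {(1,0)}" if "\<Delta> < -4" using half_units_cases 1 that by fastforce
  show "half_units = {(1,0), (b div 2, 1)}" if D: "\<Delta> = -4"
  proof -
    have "b^2 = 2*(2*(a*c) - 2)" using D by simp
    then have "even (b^2)" by (metis dvd_triv_left)
    then have b: "2 * (b div 2) = b" by simp
    have "4 * nrm (b div 2) 1 = 4" unfolding four_nrm using b D by simp
    then have "(b div 2, 1) \<in> half_units" by (simp add: half_units_def)
    then show ?thesis using half_units_cases 1 D by fastforce
  qed
  show "half_units = {(1,0), ((b + 1) div 2, 1), ((b - 1) div 2, 1)}" if D: "\<Delta> = -3"
  proof -
    have "b^2 = 2*(2*(a*c) - 2) + 1" using D by simp
    then have "odd (b^2)" by (metis even_plus_one_iff dvd_triv_left)
    then have "odd b" by simp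
    then have b: "2 * ((b + 1) div 2) = b + 1" "2 * ((b - 1) div 2) = b - 1"
      by presburger+
    have "4 * nrm ((b + 1) div 2) 1 = 4" "4 * nrm ((b - 1) div 2) 1 = 4"
      unfolding four_nrm b using D by simp_all
    then have "((b + 1) div 2, 1) \<in> half_units" "((b - 1) div 2, 1) \<in> half_units"
      by (simp_all add: half_units_def)
    then show ?thesis using half_units_cases 1 D by fastforce
  qed
qed

lemma card_half_units: "real (card half_units) = wD \<Delta>"
proof -
  have "\<Delta> = -4 \<or> \<Delta> = -3 \<or> \<Delta> < -4" using dneg disc_mod_4 by presburger
  moreover have "(b + 1) div 2 \<noteq> (b - 1) div 2" by linarith
  ultimately show ?thesis using half_units_eq by (auto simp: wD_def)
qed

text \<open>No prime divides this determinant, so by \<open>det_act_act\<close> distinct half units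
  move a good line to distinct lines: the action is free.\<close>

lemma half_units_det:
  assumes "(s,u) \<in> half_units" "(s',u') \<in> half_units" "(s,u) \<noteq> (s',u')"
  shows "\<bar>s*u' - s'*u\<bar> = 1"
  using half_units_cases[OF assms(1)] half_units_cases[OF assms(2)] assms(3) by auto

lemma det_act_act:
  "ax s u x y * ay s' u' x y - ax s' u' x y * ay s u x y = (s*u' - s'*u) * F x y"
  by (simp add: ax_def ay_def fval_def algebra_simps power2_eq_square)

lemma act_uminus: "ax (-s) (-u) x y = - ax s u x y" "ay (-s) (-u) x y = - ay s u x y"
  by (simp_all add: ax_def ay_def algebra_simps)

lemma inlat_uminus: "inlat h (-x) (-y) \<longleftrightarrow> inlat h x y"
proof -
  have "vx h * (-y) - vy h * (-x) = -(vx h * y - vy h * x)" by simp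
  then show ?thesis unfolding inlat_def by (simp only: dvd_minus_iff)
qed

definition idx :: "int \<Rightarrow> int \<Rightarrow> int" where
  "idx x y = (SOME h. h \<in> {0..P} \<and> inlat h x y)"

lemma idx: "\<not> (P dvd x \<and> P dvd y) \<Longrightarrow> idx x y \<in> {0..P} \<and> inlat (idx x y) x y"
  unfolding idx_def by (rule someI_ex) (use inlat_exists in blast)

text \<open>Applying the half units to the direction vector of h gives a bijection onto the
  sublattices in the fibre: injective by freeness, surjective because every equivalence comes from a
  unit.\<close>

lemma card_fibre:
  assumes "h \<in> {0..P}" "good h"
  shows "real (card {j\<in>{0..P}. good j \<and> cls (sub j) = cls (sub h)}) = wD \<Delta>"
proof -
  define X Y where "X = (\<lambda>(s,u). ax s u (vx h) (vy h))" and "Y = (\<lambda>(s,u). ay s u (vx h) (vy h))"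
  have unit: "nrm (fst e) (snd e) = 1" if "e \<in> half_units" for e
    using that by (auto simp: half_units_def)
  have FXY: "F (X e) (Y e) = F (vx h) (vy h)" if "e \<in> half_units" for e
    using unit[OF that] by (cases e) (simp add: X_def Y_def F_act)
  have nz: "\<not> (P dvd X e \<and> P dvd Y e)" and ndF: "\<not> P dvd F (X e) (Y e)" if "e \<in> half_units" for e
    using not_dvd_F assms(2) FXY[OF that] unfolding good_def by metis+
  have "inj_on (\<lambda>e. idx (X e) (Y e)) half_units"
  proof (rule inj_onI, rule ccontr)
    fix e e' assume e: "e \<in> half_units" "e' \<in> half_units" "idx (X e) (Y e) = idx (X e') (Y e')"
      and ne: "e \<noteq> e'"
    obtain s u s' u' where su: "e = (s,u)" "e' = (s',u')" by (cases e; cases e')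
    have "P dvd X e * Y e' - X e' * Y e"
      using idx[OF nz[OF e(1)]] idx[OF nz[OF e(2)]] e(3) inlat_det by metis
    then have "P dvd (s*u' - s'*u) * F (vx h) (vy h)"
      by (simp add: su X_def Y_def det_act_act)
    then have "P dvd s*u' - s'*u"
      using assms(2) prime_dvd_mult_iff[OF prime_P] by (auto simp: good_def)
    then have "P dvd \<bar>s*u' - s'*u\<bar>" by simp
    then show False using half_units_det e ne P_gt_1 unfolding su by fastforce
  qed
  moreover have "(\<lambda>e. idx (X e) (Y e)) ` half_units
      = {j\<in>{0..P}. good j \<and> cls (sub j) = cls (sub h)}"
  proof (intro equalityI subsetI)
    fix j assume "j \<in> (\<lambda>e. idx (X e) (Y e)) ` half_units"
    then obtain e where e: "e \<in> half_units" "j = idx (X e) (Y e)" by blast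
    then have j: "j \<in> {0..P}" "inlat j (X e) (Y e)" using idx[OF nz] by blast+
    have "sl2_equiv (sub j) (sub h)"
      using sl2_equiv_sub_of_unit[OF unit[OF e(1)] assms(2)] j(2)
      by (cases e) (simp add: X_def Y_def)
    then show "j \<in> {j\<in>{0..P}. good j \<and> cls (sub j) = cls (sub h)}"
      using j goodI[OF j(2) ndF[OF e(1)]] cls_eq_iff by blast
  next
    fix j assume "j \<in> {j\<in>{0..P}. good j \<and> cls (sub j) = cls (sub h)}"
    then have j: "j \<in> {0..P}" "good j" "sl2_equiv (sub j) (sub h)" by (auto simp: cls_eq_iff)
    obtain s u where su: "nrm s u = 1" "inlat j (ax s u (vx h) (vy h)) (ay s u (vx h) (vy h))"
      using unit_of_sl2_equiv_sub[OF j(2,3)] by blast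
    have "s \<noteq> 0 \<or> u \<noteq> 0" using su(1) by (auto simp: nrm_def)
    moreover have "nrm (-s) (-u) = 1" using su(1) by (simp add: nrm_def)
    \<comment> \<open>Opposite units move the vector into the same sublattices, and
      \<open>half_units\<close> keeps one of each pair.\<close>
    ultimately have "(s,u) \<in> half_units \<or> (-s,-u) \<in> half_units"
      using su(1) by (auto simp: half_units_def)
    then obtain e where e: "e \<in> half_units" "inlat j (X e) (Y e)"
    proof
      assume "(s,u) \<in> half_units"
      then show ?thesis using that[of "(s,u)"] su(2) by (simp add: X_def Y_def)
    next
      assume "(-s,-u) \<in> half_units"
      then show ?thesis
        using that[of "(-s,-u)"] su(2) by (simp add: X_def Y_def act_uminus inlat_uminus)
    qed
    then have "j = idx (X e) (Y e)"
      using inlat_unique[OF j(1) _ e(2)] idx[OF nz[OF e(1)]] nz[OF e(1)] by blast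
    then show "j \<in> (\<lambda>e. idx (X e) (Y e)) ` half_units" using e(1) by blast
  qed
  ultimately show ?thesis using card_half_units card_image by metis
qed

end

section \<open>Genera of restrictions\<close>

lemma odd_square_mod_8:
  fixes z :: int
  assumes "odd z"
  shows "[z^2 = 1] (mod 8)"
proof -
  obtain k where k: "z = 2*k + 1" using assms by (blast elim: oddE)
  have "2 dvd k * (k + 1)" by simp
  then obtain l where "k * (k + 1) = 2*l" by blast
  moreover have "z^2 = 4*(k*(k + 1)) + 1" by (simp add: k power2_eq_square algebra_simps)
  ultimately have "z^2 - 1 = 8*l" by simp
  then show ?thesis by (simp add: cong_iff_dvd_diff)
qed

context sublattice_forms begin

text \<open>The necessary condition for lying in one genus: values are transported up to squares
  coprime to \<open>2*D\<close>.\<close>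

lemma genus_rel_value:
  assumes "genus_rel D (sub j) (sub h)" "inlat h x y"
  shows "\<exists>z x' y'. coprime z (2*D) \<and> inlat j x' y' \<and> F x' y' = z^2 * F x y"
proof -
  obtain z al be ga de where z: "coprime z (2*D)"
    and eq: "transf (sub j) al be ga de = scale_form (z^2) (sub h)"
    using assms(1) unfolding genus_rel_iff by blast
  obtain X Y where xy: "x = m11 h * X + m12 h * Y" "y = m22 h * Y"
    using assms(2) inlat_iff by blast
  define X' Y' where "X' = al*X + be*Y" and "Y' = ga*X + de*Y"
  have "z^2 * F x y = fval (transf (sub j) al be ga de) X Y"
    by (simp add: eq fval_scale_form fval_sub xy)
  also have "\<dots> = F (m11 j * X' + m12 j * Y') (m22 j * Y')"
    by (simp add: fval_transf fval_sub X'_def Y'_def)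
  finally show ?thesis using z inlat_iff by metis
qed

text \<open>N carries the primes other than p that the norms constructed below have to
  avoid.\<close>

lemma prime_to_P_part:
  obtains e N where "2 * (\<Delta> * P^2) = P^e * N" "\<not> P dvd N"
proof -
  have "2 * (\<Delta> * P^2) \<noteq> 0" using dneg P_gt_1 by simp
  moreover have "\<not> is_unit P" using P_gt_1 by simp
  ultimately show ?thesis using multiplicity_decompose'[of "2 * (\<Delta> * P^2)" P] that by blast
qed

text \<open>Multiplicativity of norms: the right side is \<open>nrm s (-U)\<close>, where s is the
  bilinear expression and U the determinant of the two vectors.\<close>

lemma F_mult_F:
  "F x y * F x' y' = (a*x*x' + b*x'*y + c*y*y')^2 + b*(x*y' - x'*y)*(a*x*x' + b*x'*y + c*y*y')
     + a*c*(x*y' - x'*y)^2"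
  by (simp add: fval_def algebra_simps power2_eq_square)

text \<open>With \<open>\<gamma> = w \<cdot> conj w'\<close> of trace \<open>T\<close> and norm \<open>F w \<cdot> F w' \<equiv> k\<^sup>2\<close>, the element
  \<open>\<beta> = k + \<gamma>\<close> has \<open>\<beta>\<^sup>2 \<equiv> (2k + T) \<gamma>\<close> modulo \<open>p\<close>, so \<open>\<beta>\<^sup>2\<close> carries the line of \<open>w'\<close> to that of \<open>w\<close>.
  The Chinese remainder theorem makes \<open>\<beta>\<close> trivial at the other primes dividing \<open>2\<Delta>\<close>.\<close>

lemma genus_rel_of_square:
  assumes "inlat j x y" "inlat h x' y'" "\<not> P dvd F x y" "\<not> P dvd F x' y'"
    and k: "[F x y * F x' y' = k^2] (mod P)"
    and T: "\<not> P dvd 2*k + (2*a*x*x' + b*(x*y' + x'*y) + 2*c*y*y')"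
  shows "genus_rel (\<Delta> * P^2) (sub j) (sub h)"
proof -
  obtain e N where eN: "2 * (\<Delta> * P^2) = P^e * N" "\<not> P dvd N" by (rule prime_to_P_part)
  have "coprime P N" using prime_imp_coprime[OF prime_P eN(2)] .
  then obtain q where q: "[q = 1] (mod P)" "[q = 0] (mod N)"
    using binary_chinese_remainder_int by blast
  define s0 U where "s0 = a*x*x' + b*x'*y + c*y*y'" and "U = x*y' - x'*y"
  \<comment> \<open>Interpolates between the coordinates (k + s0, -U) of the element k + w conj w'
    modulo p and those of 1 modulo N.\<close>
  define s1 u1 where "s1 = 1 + q*(k + s0 - 1)" and "u1 = q*(-U)"
  define z where "z = nrm s1 u1"
  have cong_nrm: "[nrm s u = nrm s' u'] (mod M)" 
    if "[s = s'] (mod M)" "[u = u'] (mod M)" for s u s' u' M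
    unfolding nrm_def using that by (intro cong_diff cong_add cong_mult cong_refl cong_pow)
  have "[1 + q*(k + s0 - 1) = 1 + 1*(k + s0 - 1)] (mod P)"
    using q(1) by (intro cong_add cong_mult cong_refl)
  then have s1P: "[s1 = k + s0] (mod P)" by (simp add: s1_def)
  have u1P: "[u1 = -U] (mod P)"
    using cong_mult[OF q(1) cong_refl[of "-U"]] by (simp add: u1_def)
  have "[1 + q*(k + s0 - 1) = 1 + 0*(k + s0 - 1)] (mod N)"
    using q(2) by (intro cong_add cong_mult cong_refl)
  then have s1N: "[s1 = 1] (mod N)" by (simp add: s1_def)
  have u1N: "[u1 = 0] (mod N)"
    using cong_mult[OF q(2) cong_refl[of "-U"]] by (simp add: u1_def)
  have FF: "F x y * F x' y' = s0^2 + b*U*s0 + a*c*U^2"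
    by (simp add: F_mult_F s0_def U_def)
  have "[z = nrm (k + s0) (-U)] (mod P)" unfolding z_def using s1P u1P by (rule cong_nrm)
  also have "nrm (k + s0) (-U) = F x y * F x' y' + (k^2 + k*(2*s0 + b*U))"
    unfolding FF by (simp add: nrm_def algebra_simps power2_eq_square)
  also have "[\<dots> = k^2 + (k^2 + k*(2*s0 + b*U))] (mod P)"
    using k by (intro cong_add cong_refl)
  also have "k^2 + (k^2 + k*(2*s0 + b*U)) = k*(2*k + (2*a*x*x' + b*(x*y' + x'*y) + 2*c*y*y'))"
    by (simp add: s0_def U_def algebra_simps power2_eq_square)
  finally have zP: "[z = k*(2*k + (2*a*x*x' + b*(x*y' + x'*y) + 2*c*y*y'))] (mod P)" .
  have "\<not> P dvd k"
  proof
    assume "P dvd k"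
    then have "P dvd k^2" by (simp add: power2_eq_square)
    then have "P dvd F x y * F x' y'" using k cong_dvd_iff by blast
    then show False using assms(3,4) prime_dvd_mult_iff[OF prime_P] by blast
  qed
  then have "\<not> P dvd z" using zP T cong_dvd_iff prime_dvd_mult_iff[OF prime_P] by blast
  then have "coprime z P" using prime_imp_coprime[OF prime_P] coprime_commute by blast
  moreover have "[z = nrm 1 0] (mod N)" unfolding z_def using s1N u1N by (rule cong_nrm)
  then have "[z = 1] (mod N)" by (simp add: nrm_def)
  then have "coprime z N" using cong_imp_coprime[of 1 z N] cong_sym by auto
  ultimately have cop: "coprime z (2 * (\<Delta> * P^2))" unfolding eN(1) by simp
  \<comment> \<open>The coordinates of the square of s1 + u1 omega, computed from omega^2 = -b omega
    - a c.\<close>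
  define S W where "S = s1^2 - a*c*u1^2" and "W = 2*s1*u1 - b*u1^2"
  have SW: "nrm S W = z^2"
    by (simp add: nrm_def S_def W_def z_def algebra_simps power2_eq_square)
  have "[S*U + W*s0 = ((k + s0)^2 - a*c*(-U)^2)*U + (2*(k + s0)*(-U) - b*(-U)^2)*s0] (mod P)"
    unfolding S_def W_def using s1P u1P
    by (intro cong_add cong_diff cong_mult cong_refl cong_pow)
  also have "((k + s0)^2 - a*c*(-U)^2)*U + (2*(k + s0)*(-U) - b*(-U)^2)*s0
      = U * (k^2 - F x y * F x' y')"
    unfolding FF by (simp add: algebra_simps power2_eq_square)
  finally have "[S*U + W*s0 = U * (k^2 - F x y * F x' y')] (mod P)" .
  moreover have "P dvd k^2 - F x y * F x' y'"
    using k by (simp add: cong_iff_dvd_diff dvd_diff_commute)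
  ultimately have "P dvd S*U + W*s0" using cong_dvd_iff by (metis dvd_mult)
  then have "P dvd S*(x*y' - x'*y) + W*(a*x*x' + b*x'*y + c*y*y')" by (simp add: U_def s0_def)
  from similitude_sub[OF assms(1) not_dvd_F[OF assms(3)] assms(2) not_dvd_F[OF assms(4)] this]
  show ?thesis unfolding genus_rel_iff SW using cop by blast
qed

text \<open>For b = 2b' one has omega = -b' + sqrt m with m = b'^2 - a c. This restates the
  criterion for the element S + W sqrt m, whose norm is S^2 - m W^2.\<close>

lemma genus_rel_of_even_similitude:
  assumes "inlat j x y" "inlat h x' y'" "\<not> P dvd F x y" "\<not> P dvd F x' y'"
    and b: "b = 2*b'"
    and z: "S^2 - (b'^2 - a*c)*W^2 = z^2" "coprime z (2 * (\<Delta> * P^2))"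
    and d: "P dvd S*(x*y' - x'*y) + W*(a*x*x' + b'*(x*y' + x'*y) + c*y*y')"
  shows "genus_rel (\<Delta> * P^2) (sub j) (sub h)"
proof -
  have 1: "nrm (S + b'*W) W = z^2"
    unfolding z(1)[symmetric] nrm_def by (simp add: b algebra_simps power2_eq_square)
  have "P dvd (S + b'*W)*(x*y' - x'*y) + W*(a*x*x' + b*x'*y + c*y*y')"
    using d by (simp add: b algebra_simps)
  from similitude_sub[OF assms(1) not_dvd_F[OF assms(3)] assms(2) not_dvd_F[OF assms(4)] this]
  show ?thesis unfolding genus_rel_iff 1 using z(2) by blast
qed

text \<open>Necessity compares values on one sublattice up to squares. For sufficiency both k and -k
  are square roots, and 2k + T and -2k + T differ by 4k, which is prime to p; so
  \<open>genus_rel_of_square\<close> applies to one of them.\<close>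

lemma genus_rel_odd_iff:
  assumes "odd p" "inlat j x y" "inlat h x' y'" "\<not> P dvd F x y" "\<not> P dvd F x' y'"
  shows "genus_rel (\<Delta> * P^2) (sub j) (sub h) \<longleftrightarrow> QuadRes P (F x y * F x' y')"
proof
  assume "genus_rel (\<Delta> * P^2) (sub j) (sub h)"
  from genus_rel_value[OF this assms(3)] obtain z X Y where
    z: "coprime z (2 * (\<Delta> * P^2))" "inlat j X Y" "F X Y = z^2 * F x' y'" by blast
  obtain l where l: "[F x y = l^2 * F (vx j) (vy j)] (mod P)"
    using inlat_multiple_v[OF assms(2)] by blast
  obtain k where k: "[F X Y = k^2 * F (vx j) (vy j)] (mod P)"
    using inlat_multiple_v[OF z(2)] by blast
  have "coprime z P" using z(1) by (simp add: power2_eq_square)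
  then obtain i where i: "[z * i = 1] (mod P)" using cong_solve_coprime_int by blast
  \<comment> \<open>Both values on j are squares times the value at its direction vector, so their
    product is a square modulo p; the inverse i of z then removes \<open>z^2\<close>.\<close>
  have "[(i * l * k * F (vx j) (vy j))^2 = i^2 * (F x y * F X Y)] (mod P)"
  proof -
    have "(i * l * k * F (vx j) (vy j))^2
        = i^2 * ((l^2 * F (vx j) (vy j)) * (k^2 * F (vx j) (vy j)))"
      by (simp add: power2_eq_square algebra_simps)
    also have "[\<dots> = i^2 * (F x y * F X Y)] (mod P)"
      using l k by (intro cong_mult cong_refl) (simp_all add: cong_sym)
    finally show ?thesis .
  qed
  also have "i^2 * (F x y * F X Y) = (z * i)^2 * (F x y * F x' y')"
    by (simp add: z(3) power2_eq_square algebra_simps)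
  also have "[\<dots> = 1^2 * (F x y * F x' y')] (mod P)"
    using i by (intro cong_mult cong_pow cong_refl)
  finally show "QuadRes P (F x y * F x' y')" unfolding QuadRes_def by auto
next
  assume "QuadRes P (F x y * F x' y')"
  then obtain k where k: "[F x y * F x' y' = k^2] (mod P)"
    unfolding QuadRes_def using cong_sym by blast
  define T where "T = 2*a*x*x' + b*(x*y' + x'*y) + 2*c*y*y'"
  have "\<not> P dvd k"
  proof
    assume "P dvd k"
    then have "P dvd k^2" by (simp add: power2_eq_square)
    then have "P dvd F x y * F x' y'" using k cong_dvd_iff by blast
    then show False using assms(4,5) prime_dvd_mult_iff[OF prime_P] by blast
  qed
  moreover have "\<not> P dvd 4"
  proof
    assume "P dvd 4"
    then have "P dvd 2 * 2" by simp
    then have "P dvd 2" using prime_dvd_mult_iff[OF prime_P] by blast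
    then have "P = 2" using prime_P primes_dvd_imp_eq two_is_prime_nat
      by (metis of_nat_numeral prime_nat_int_transfer)
    then show False using assms(1) by auto
  qed
  ultimately have "\<not> P dvd 4 * k" using prime_dvd_mult_iff[OF prime_P] by blast
  moreover have "(2*k + T) - (2*(-k) + T) = 4*k" by simp
  ultimately have "\<not> P dvd 2*k + T \<or> \<not> P dvd 2*(-k) + T" by (metis dvd_diff)
  then show "genus_rel (\<Delta> * P^2) (sub j) (sub h)"
  proof
    assume "\<not> P dvd 2*k + T"
    then show ?thesis using genus_rel_of_square[OF assms(2-5) k] by (simp add: T_def)
  next
    assume "\<not> P dvd 2*(-k) + T"
    moreover have "[F x y * F x' y' = (-k)^2] (mod P)" using k by simp
    ultimately show ?thesis using genus_rel_of_square[OF assms(2-5)] unfolding T_def by blast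
  qed
qed

section \<open>The prime 2\<close>

definition texp :: nat where
  "texp = (if 16 dvd \<Delta> then 2 else if odd \<Delta> then 0 else 1)"

lemma even_disc: "even \<Delta> \<longleftrightarrow> even b"
  by simp

text \<open>The odd values on a sublattice of index 2 come from a single vector modulo 2, so this
  makes them agree modulo \<open>2^(texp + 1)\<close>. For even b the difference has a visible
  factor 4.\<close>

lemma F_cong_2:
  assumes "[x = x'] (mod 2)" "[y = y'] (mod 2)" "odd (F x y)"
  shows "[F x' y' = F x y] (mod 2^(texp + 1))"
proof -
  obtain d where d: "x' = x + 2*d" using assms(1) by (metis cong_iff_lin cong_sym)
  obtain e where e: "y' = y + 2*e" using assms(2) by (metis cong_iff_lin cong_sym)
  consider "odd \<Delta>" | "even \<Delta>" "\<not> 16 dvd \<Delta>" | "16 dvd \<Delta>" by blast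
  then show ?thesis
  proof cases
    case 1
    then have "texp = 0" unfolding texp_def by (metis dvd_trans even_numeral)
    then show ?thesis using F_cong[OF assms(1,2)] by (simp add: cong_sym)
  next
    case 2
    then obtain b' where b: "b = 2*b'" using even_disc by blast
    have "F x' y' - F x y = 4*(a*x*d + b'*(x*e + y*d) + c*y*e + F d e)"
      by (simp add: fval_def d e b algebra_simps power2_eq_square)
    then have "4 dvd F x' y' - F x y" by simp
    moreover have "texp = 1" unfolding texp_def using 2 by simp
    ultimately show ?thesis by (simp add: cong_iff_dvd_diff)
  next
    case 3
    then have "even \<Delta>" by (metis dvd_trans even_numeral)
    then obtain b' where b: "b = 2*b'" using even_disc by blast
    have "4*4 dvd 4*(b'^2 - a*c)" using 3 by (simp add: b power2_eq_square algebra_simps)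
    then have "4 dvd b'^2 - a*c" by (subst (asm) dvd_mult_cancel_left) simp
    then have "even (b'^2 - a*c)" by (metis dvd_trans even_numeral)
    then have b': "even b' \<longleftrightarrow> even a \<or> even c" by simp
    have "F x y = a*x^2 + c*y^2 + 2*(b'*x*y)" by (simp add: fval_def b)
    then have o: "odd (a*x^2 + c*y^2)" using assms(3) by simp
    have eq: "F x' y' - F x y = 4*(a*x*d + b'*(x*e + y*d) + c*y*e + (a*d^2 + 2*(b'*d*e) + c*e^2))"
      by (simp add: fval_def d e b algebra_simps power2_eq_square)
    \<comment> \<open>Modulo 2, b' = ac and F x y = ax + cy is 1, so the bracket is (ax + cy + 1)(ad
      + ce), which vanishes.\<close>
    have "even (a*x*d + b'*(x*e + y*d) + c*y*e + (a*d^2 + 2*(b'*d*e) + c*e^2))"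
      using b' o by auto
    then obtain l where "a*x*d + b'*(x*e + y*d) + c*y*e + (a*d^2 + 2*(b'*d*e) + c*e^2) = 2*l" by blast
    then have "F x' y' - F x y = 8*l" unfolding eq by simp
    then have "8 dvd F x' y' - F x y" by simp
    moreover have "texp = 2" unfolding texp_def using 3 by simp
    ultimately show ?thesis by (simp add: cong_iff_dvd_diff)
  qed
qed

text \<open>If U is even, the two sublattices coincide. If U is odd,
  \<open>genus_rel_of_square\<close> serves for odd discriminant and explicit elements in sqrt m for
  even discriminant; the factor N on the root keeps their norms coprime to N.\<close>

lemma genus_rel_two:
  assumes p2: "p = 2" and jh: "j \<in> {0..P}" "h \<in> {0..P}"
    and lat: "inlat j x y" "inlat h x' y'" and nd: "\<not> P dvd F x y" "\<not> P dvd F x' y'"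
    and cong: "[F x y = F x' y'] (mod 2^(texp + 1))"
  shows "genus_rel (\<Delta> * P^2) (sub j) (sub h)"
proof -
  define U where "U = x*y' - x'*y"
  have o: "odd (F x y)" "odd (F x' y')" using nd p2 by auto
  obtain e N where eN: "2 * (\<Delta> * P^2) = P^e * N" "\<not> P dvd N" by (rule prime_to_P_part)
  have N: "odd N" using eN(2) p2 by simp
  then obtain n where n: "N^2 = 8*n + 1"
    using odd_square_mod_8 by (metis cong_iff_lin cong_sym add.commute)
  have copI: "coprime z (2 * (\<Delta> * P^2))" if "odd z" "coprime z N" for z
    unfolding eN(1) using that p2 by simp
  show ?thesis
  proof (cases "even U")
    case True
    then have "inlat j x' y'" using inlat_of_det[OF lat(1) not_dvd_F[OF nd(1)]] p2 by (simp add: U_def)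
    then have "j = h" using inlat_unique[OF jh _ lat(2)] not_dvd_F[OF nd(2)] by blast
    then show ?thesis using genus_rel_of_sl2_equiv sl2_equiv_refl by blast
  next
    case U: False
    then obtain v where v: "U^2 = 8*v + 1"
      using odd_square_mod_8 by (metis cong_iff_lin cong_sym add.commute)
    show ?thesis
    proof (cases "odd \<Delta>")
      case True
      \<comment> \<open>The trace of w conj w'. Modulo 4 its square is the discriminant times U^2,
        so T is odd and k = 1 is admissible.\<close>
      define T where "T = 2*a*x*x' + b*(x*y' + x'*y) + 2*c*y*y'"
      have "\<Delta> * U^2 = T^2 - 2*(2*(F x y * F x' y'))"
        by (simp add: T_def U_def fval_def algebra_simps power2_eq_square)
      moreover have "odd (\<Delta> * U^2)" using True U by (simp only: even_mult_iff even_power) simp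
      ultimately have "odd T" by (metis dvd_diff dvd_triv_left even_power zero_less_numeral)
      then have "\<not> P dvd 2*1 + T" using p2 by simp
      moreover have "[F x y * F x' y' = 1^2] (mod P)"
        using o p2 by (simp add: cong_def mod_2_eq_odd)
      ultimately show ?thesis using genus_rel_of_square[OF lat nd] unfolding T_def by blast
    next
      case False
      then obtain b' where b: "b = 2*b'" using even_disc by blast
      define m T where "m = b'^2 - a*c" and "T = a*x*x' + b'*(x*y' + x'*y) + c*y*y'"
      have D: "\<Delta> = 4*m" by (simp add: b m_def power2_eq_square)
      have FF: "F x y * F x' y' = T^2 - m*U^2"
        by (simp add: T_def U_def m_def b fval_def algebra_simps power2_eq_square)
      note sim = genus_rel_of_even_similitude[OF lat nd b, folded m_def U_def T_def]
      show ?thesis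
      proof (cases "16 dvd \<Delta>")
        case True
        then have "4*4 dvd 4*m" by (simp add: D)
        then have "4 dvd m" by (subst (asm) dvd_mult_cancel_left) simp
        then obtain m' where m: "m = 4*m'" by blast
        have "texp = 2" unfolding texp_def using True by simp
        then have "[F x y = F x' y'] (mod 8)" using cong by simp
        then have "[F x y * F x' y' = F x' y' * F x' y'] (mod 8)" by (intro cong_mult cong_refl)
        also have "[F x' y' * F x' y' = 1] (mod 8)"
          using odd_square_mod_8[OF o(2)] by (simp add: power2_eq_square)
        finally have "8 dvd T^2 - m*U^2 - 1" unfolding FF by (simp add: cong_iff_dvd_diff)
        then obtain l where l: "T^2 - m*U^2 - 1 = 8*l" by blast
        then have "T^2 = 2*(4*l + 2*m'*U^2) + 1" by (simp add: m)
        then have "odd (T^2)" by (metis even_plus_one_iff dvd_triv_left)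
        then have oT: "odd T" by simp
        then obtain t where "T^2 = 8*t + 1"
          using odd_square_mod_8 by (metis cong_iff_lin cong_sym add.commute)
        \<comment> \<open>T^2 and U^2 are both 1 modulo 8, so T^2 - m U^2 = 1 modulo 8 forces 8 |
          m.\<close>
        then have "4*m' = 8*(t - l - 4*m'*v)" using l by (simp add: m v algebra_simps)
        then have m': "even m'" by presburger
        \<comment> \<open>The similitude is \<open>(1 + N\<surd>m')\<^sup>2\<close>, with \<open>2\<surd>m' = \<surd>m\<close>.\<close>
        define z where "z = 1 - m'*N^2"
        have "odd z" using m' by (simp add: z_def)
        moreover have "coprime z N"
        proof (rule coprimeI)
          fix d assume "d dvd z" "d dvd N"
          then have "d dvd z + (m'*N)*N" by (intro dvd_add dvd_mult)
          then show "is_unit d" by (simp add: z_def power2_eq_square)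
        qed
        ultimately have "coprime z (2 * (\<Delta> * P^2))" by (rule copI)
        moreover have "(1 + m'*N^2)^2 - m*N^2 = z^2"
          by (simp add: z_def m algebra_simps power2_eq_square)
        moreover have "P dvd (1 + m'*N^2)*U + N*T" using p2 m' U N oT by simp
        ultimately show ?thesis using sim by blast
      next
        case n16: False
        have "texp = 1" unfolding texp_def using n16 False by simp
        then have "[F x y = F x' y'] (mod 4)" using cong by simp
        then have "[F x y * F x' y' = F x' y' * F x' y'] (mod 4)" by (intro cong_mult cong_refl)
        also have "[F x' y' * F x' y' = 1] (mod 4)"
          using odd_square_mod_8[OF o(2)] by (auto simp: power2_eq_square cong_iff_dvd_diff)
        finally have "4 dvd T^2 - m*U^2 - 1" unfolding FF by (simp add: cong_iff_dvd_diff)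
        then obtain l where l: "T^2 - m*U^2 - 1 = 4*l" by blast
        \<comment> \<open>An odd T would give 4 | m, so 16 would divide the discriminant. With T
          even, the same equation forces m = 3 modulo 4.\<close>
        have eT: "even T"
        proof (rule ccontr)
          assume "odd T"
          then obtain t where "T^2 = 8*t + 1"
            using odd_square_mod_8 by (metis cong_iff_lin cong_sym add.commute)
          then have "m = 4*(2*t - l - 2*m*v)" using l by (simp add: v algebra_simps)
          then have "4*4 dvd 4*m" by (metis dvd_triv_left mult_dvd_mono dvd_refl)
          then show False using n16 by (simp add: D)
        qed
        then obtain T' where T': "T = 2*T'" by blast
        have m: "m = 4*(T'^2 - l - 2*m*v - 1) + 3" 
          using l unfolding v T' by (simp add: power2_eq_square algebra_simps)
        then obtain m' where m': "m = 4*m' + 3" by blast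
        \<comment> \<open>Chosen so that m N^2 = 4k + 3: then 1 + m N^2 is twice an even number and
          1 - m N^2 twice an odd one.\<close>
        define k where "k = 8*m'*n + m' + 6*n"
        have mN: "m*N^2 = 4*k + 3" by (simp add: m' n k_def algebra_simps)
        \<comment> \<open>The similitude is \<open>(1 + N\<surd>m)\<^sup>2 / 2\<close>.\<close>
        define S z where "S = 2*k + 2" and "z = -(2*k + 1)"
        have z2: "2*z = 1 - m*N^2" and S2: "2*S = 1 + m*N^2" by (simp_all add: mN S_def z_def)
        have "odd z" by (simp add: z_def)
        moreover have "coprime z N"
        proof (rule coprimeI)
          fix d assume "d dvd z" "d dvd N"
          then have "d dvd 2*z + (m*N)*N" by (intro dvd_add dvd_mult)
          then show "is_unit d" by (simp add: z2 power2_eq_square)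
        qed
        ultimately have "coprime z (2 * (\<Delta> * P^2))" by (rule copI)
        moreover have "S^2 - m*N^2 = z^2"
          unfolding mN by (simp add: S_def z_def power2_eq_square algebra_simps)
        moreover have "P dvd S*U + N*T" using p2 eT by (simp add: S_def)
        ultimately show ?thesis using sim by blast
      qed
    qed
  qed
qed

lemma genus_rel_two_iff:
  assumes p2: "p = 2" and jh: "j \<in> {0..P}" "h \<in> {0..P}"
    and lat: "inlat j x y" "inlat h x' y'" and nd: "\<not> P dvd F x y" "\<not> P dvd F x' y'"
  shows "genus_rel (\<Delta> * P^2) (sub j) (sub h) \<longleftrightarrow> [F x y = F x' y'] (mod 2^(texp + 1))"
proof
  assume "genus_rel (\<Delta> * P^2) (sub j) (sub h)"
  from genus_rel_value[OF this lat(2)] obtain z X Y where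
    z: "coprime z (2 * (\<Delta> * P^2))" "inlat j X Y" "F X Y = z^2 * F x' y'" by blast
  have oz: "odd z" using z(1) by simp
  have oX: "odd (F X Y)" using z(3) oz nd(2) p2 by simp
  have "\<not> (even X \<and> even Y)" "\<not> (even x \<and> even y)"
    using not_dvd_F[OF nd(1)] not_dvd_F[of X Y] oX p2 by auto
  \<comment> \<open>A line modulo 2 contains only one nonzero vector, so (X, Y) and (x, y) agree
    modulo 2.\<close>
  moreover have "even (x*Y - X*y)" using inlat_det[OF lat(1) z(2)] p2 by simp
  ultimately have "even X \<longleftrightarrow> even x" "even Y \<longleftrightarrow> even y" by auto
  then have "[X = x] (mod 2)" "[Y = y] (mod 2)" by (auto simp: cong_def mod_2_eq_odd)
  from F_cong_2[OF this oX] have "[F x y = z^2 * F x' y'] (mod 2^(texp + 1))" by (simp add: z(3))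
  also have "[z^2 * F x' y' = 1 * F x' y'] (mod 2^(texp + 1))"
  proof (intro cong_mult cong_refl)
    have "(2::int)^(texp + 1) dvd 2^3" by (rule le_imp_power_dvd) (simp add: texp_def)
    then show "[z^2 = 1] (mod 2^(texp + 1))"
      using odd_square_mod_8[OF oz] by (simp add: cong_iff_dvd_diff) (metis dvd_trans)
  qed
  finally show "[F x y = F x' y'] (mod 2^(texp + 1))" by simp
qed (rule genus_rel_two[OF assms])

end

section \<open>Counting representations\<close>

context sublattice_forms begin

definition reps :: "nat \<Rightarrow> (int \<times> int) set" where
  "reps n = {w. F (fst w) (snd w) = int n}"

lemma theta_eq_card_reps: "theta (a,b,c) n = real (card (reps n))"
  by (simp add: theta_def reps_def)

text \<open>Completing the square in 4aF and in 4cF bounds y and x respectively.\<close>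

lemma finite_reps: "finite (reps n)"
proof -
  have "4*a*c > 0" using dneg zero_le_power2[of b] by linarith
  then have cpos: "c > 0" using apos by (simp add: zero_less_mult_iff)
  have bound: "\<bar>y\<bar> \<le> M" if "s^2 - \<Delta> * y^2 = M" for s y M :: int
  proof -
    have "\<Delta> * y^2 \<le> (-1) * y^2" using dneg by (intro mult_right_mono) auto
    moreover have "s^2 \<ge> 0" by simp
    ultimately have "y^2 \<le> M" using that by linarith
    moreover have "\<bar>y\<bar> \<le> y^2"
    proof (cases "y = 0")
      case False
      then have "\<bar>y\<bar> * 1 \<le> \<bar>y\<bar> * \<bar>y\<bar>" by (intro mult_left_mono) auto
      then show ?thesis by (simp add: power2_eq_square)
    qed simp
    ultimately show ?thesis by linarith
  qed
  have "reps n \<subseteq> {-(4*c*int n)..4*c*int n} \<times> {-(4*a*int n)..4*a*int n}"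
  proof
    fix w assume w: "w \<in> reps n"
    obtain x y where xy: "w = (x,y)" by (cases w)
    then have F: "a*x^2 + b*x*y + c*y^2 = int n" using w by (simp add: reps_def fval_def)
    have "(2*a*x + b*y)^2 - \<Delta> * y^2 = 4*a*(a*x^2 + b*x*y + c*y^2)"
      "(2*c*y + b*x)^2 - \<Delta> * x^2 = 4*c*(a*x^2 + b*x*y + c*y^2)"
      by (simp_all add: algebra_simps power2_eq_square)
    then have "\<bar>y\<bar> \<le> 4*a*int n" "\<bar>x\<bar> \<le> 4*c*int n" unfolding F by (auto intro: bound)
    then show "w \<in> {-(4*c*int n)..4*c*int n} \<times> {-(4*a*int n)..4*a*int n}"
      by (simp add: xy abs_le_iff)
  qed
  then show ?thesis by (rule finite_subset) simp
qed

lemma theta_sub: "theta (sub h) n = real (card {w \<in> reps n. inlat h (fst w) (snd w)})"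
proof -
  define g where "g = (\<lambda>(X,Y). (m11 h * X + m12 h * Y, m22 h * Y))"
  have "m11 h \<noteq> 0" "m22 h \<noteq> 0" using det_basis[of h] P_gt_1 by auto
  then have "inj g" by (auto simp: inj_def g_def)
  then have inj: "inj_on g {w. fval (sub h) (fst w) (snd w) = int n}" by (rule inj_on_subset) simp
  have img: "g ` {w. fval (sub h) (fst w) (snd w) = int n}
      = {w \<in> reps n. inlat h (fst w) (snd w)}"
  proof (intro equalityI subsetI)
    fix w assume "w \<in> g ` {w. fval (sub h) (fst w) (snd w) = int n}"
    then obtain X Y where "w = g (X,Y)" "fval (sub h) X Y = int n" by auto
    then show "w \<in> {w \<in> reps n. inlat h (fst w) (snd w)}"
      using inlat_iff by (auto simp: g_def reps_def fval_sub)
  next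
    fix w assume w: "w \<in> {w \<in> reps n. inlat h (fst w) (snd w)}"
    then obtain X Y where "fst w = m11 h * X + m12 h * Y" "snd w = m22 h * Y"
      using inlat_iff by blast
    then have "w = g (X,Y)" by (simp add: g_def prod_eq_iff)
    moreover have "fval (sub h) X Y = int n" using w calculation by (simp add: fval_sub reps_def g_def)
    ultimately show "w \<in> g ` {w. fval (sub h) (fst w) (snd w) = int n}"
      by (intro image_eqI[of _ _ "(X,Y)"]) simp_all
  qed
  show ?thesis by (simp only: theta_def img[symmetric] card_image[OF inj])
qed

lemma card_reps_multiples:
  "real (card {w \<in> reps n. P dvd fst w \<and> P dvd snd w}) = theta_pow (a,b,c) (p^2) n"
proof (cases "p^2 dvd n")
  case True
  then obtain k where k: "n = p^2 * k" by blast
  have p0: "p > 0" using P_gt_1 by simp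
  define g where "g = (\<lambda>(x,y). (P * x, P * y))"
  have inj: "inj_on g (reps k)" using p0 by (auto simp: inj_on_def g_def)
  have img: "g ` reps k = {w \<in> reps n. P dvd fst w \<and> P dvd snd w}"
  proof (intro equalityI subsetI)
    fix w assume "w \<in> g ` reps k"
    then show "w \<in> {w \<in> reps n. P dvd fst w \<and> P dvd snd w}"
      by (auto simp: g_def reps_def F_scale k)
  next
    fix w assume w: "w \<in> {w \<in> reps n. P dvd fst w \<and> P dvd snd w}"
    then obtain x y where xy: "fst w = P * x" "snd w = P * y" by (auto elim!: dvdE)
    have "P^2 * F x y = P^2 * int k" using w by (simp add: reps_def xy F_scale k)
    then have "(x,y) \<in> reps k" using p0 by (simp add: reps_def)
    moreover have "w = g (x,y)" by (simp add: g_def xy prod_eq_iff)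
    ultimately show "w \<in> g ` reps k" by blast
  qed
  have "card {w \<in> reps n. P dvd fst w \<and> P dvd snd w} = card (reps k)"
    by (simp only: img[symmetric] card_image[OF inj])
  moreover have "n div p^2 = k" using k p0 by simp
  ultimately show ?thesis using True by (simp add: theta_pow_def theta_eq_card_reps)
next
  case False
  have "{w \<in> reps n. P dvd fst w \<and> P dvd snd w} = {}"
  proof -
    have "p^2 dvd n" if "F x y = int n" "P dvd x" "P dvd y" for x y
      using F_multiple[OF that(2,3)] that(1) by (simp flip: of_nat_power)
    then show ?thesis using False by (auto simp: reps_def)
  qed
  then show ?thesis using False by (simp only: theta_pow_def) simp
qed

definition good_in :: "form set set \<Rightarrow> int set" where
  "good_in G = {h \<in> {0..P}. good h \<and> cls (sub h) \<in> G}"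

lemma finite_good_in: "finite (good_in G)"
  unfolding good_in_def by (rule finite_Collect_conjI) simp

lemma Psi_Int: "Psi p (a,b,c) \<inter> G = (\<lambda>h. cls (sub h)) ` good_in G"
proof -
  have "Psi p (a,b,c) = (\<lambda>h. cls (sub h)) ` {h \<in> {0..P}. good h}"
  proof (intro equalityI subsetI)
    fix C assume "C \<in> Psi p (a,b,c)"
    then obtain g where g: "C = cls g" "primitive g" "g = (a, b*P, c*P^2) \<or>
        (\<exists>h\<in>{0..<P}. g = (a*P^2, P*(b + 2*a*h), a*h^2 + b*h + c))"
      unfolding Psi_def by auto
    from g(3) obtain h where "h \<in> {0..P}" "g = sub h"
    proof
      assume "g = (a, b*P, c*P^2)"
      then show ?thesis using that[of P] by (simp add: sub_explicit)
    next
      assume "\<exists>h\<in>{0..<P}. g = (a*P^2, P*(b + 2*a*h), a*h^2 + b*h + c)"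
      then obtain h where "h \<in> {0..<P}" "g = (a*P^2, P*(b + 2*a*h), a*h^2 + b*h + c)" by blast
      then show ?thesis using that[of h] by (simp add: sub_explicit)
    qed
    then show "C \<in> (\<lambda>h. cls (sub h)) ` {h \<in> {0..P}. good h}"
      using g(1,2) primitive_sub_iff by blast
  next
    fix C assume "C \<in> (\<lambda>h. cls (sub h)) ` {h \<in> {0..P}. good h}"
    then obtain h where h: "h \<in> {0..P}" "good h" "C = cls (sub h)" by blast
    have "sub h = (a, b*P, c*P^2) \<or>
        (\<exists>k\<in>{0..<P}. sub h = (a*P^2, P*(b + 2*a*k), a*k^2 + b*k + c))"
    proof (cases "h = P")
      case True
      then show ?thesis by (simp add: sub_explicit)
    next
      case False
      then have "h \<in> {0..<P}" using h(1) by simp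
      moreover have "sub h = (a*P^2, P*(b + 2*a*h), a*h^2 + b*h + c)"
        using False by (simp add: sub_explicit)
      ultimately show ?thesis by blast
    qed
    moreover have "primitive (sub h)" using h(2) primitive_sub_iff by blast
    ultimately show "C \<in> Psi p (a,b,c)"
      unfolding Psi_def prod.case h(3) by (intro CollectI exI[of _ "sub h"]) simp
  qed
  then show ?thesis by (auto simp: good_in_def)
qed

text \<open>Source of the factor w: by \<open>card_fibre\<close> each class arises from w
  sublattices, so sums over classes become sums over sublattices.\<close>

lemma sum_Psi_Int:
  "wD \<Delta> * (\<Sum>C\<in>Psi p (a,b,c) \<inter> G. \<phi> C) = (\<Sum>h\<in>good_in G. \<phi> (cls (sub h)))"
proof -
  have "(\<Sum>h\<in>good_in G. \<phi> (cls (sub h)))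
      = (\<Sum>C\<in>Psi p (a,b,c) \<inter> G. \<Sum>h\<in>{h\<in>good_in G. cls (sub h) = C}. \<phi> (cls (sub h)))"
    unfolding Psi_Int by (rule sum.image_gen[OF finite_good_in])
  also have "\<dots> = (\<Sum>C\<in>Psi p (a,b,c) \<inter> G. wD \<Delta> * \<phi> C)"
  proof (rule sum.cong[OF refl])
    fix C assume "C \<in> Psi p (a,b,c) \<inter> G"
    then obtain h where h: "h \<in> {0..P}" "good h" "C = cls (sub h)" "C \<in> G"
      unfolding Psi_Int good_in_def by blast
    then have "{h\<in>good_in G. cls (sub h) = C} = {j\<in>{0..P}. good j \<and> cls (sub j) = cls (sub h)}"
      by (auto simp: good_in_def)
    then have "real (card {h\<in>good_in G. cls (sub h) = C}) = wD \<Delta>"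
      using card_fibre[OF h(1,2)] by simp
    then show "(\<Sum>h\<in>{h\<in>good_in G. cls (sub h) = C}. \<phi> (cls (sub h))) = wD \<Delta> * \<phi> C" by simp
  qed
  finally show ?thesis by (simp add: sum_distrib_left)
qed

text \<open>On a good sublattice the values divisible by p occur only at multiples of p, which
  contribute the series in q^(p^2).\<close>

lemma theta_sub_good:
  assumes "good h"
  shows "theta (sub h) n = theta_pow (a,b,c) (p^2) n +
    real (card {w \<in> reps n. \<not> p dvd n \<and> inlat h (fst w) (snd w)})"
proof -
  have eq: "{w \<in> reps n. inlat h (fst w) (snd w)} = {w \<in> reps n. P dvd fst w \<and> P dvd snd w} \<union>
      {w \<in> reps n. \<not> p dvd n \<and> inlat h (fst w) (snd w)}" (is "_ = ?A \<union> ?B")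
  proof -
    have "P dvd fst w \<and> P dvd snd w" if "w \<in> reps n" "inlat h (fst w) (snd w)" "p dvd n" for w
      using good_dvd[OF assms that(2)] that(1,3) by (simp add: reps_def)
    then show ?thesis using inlat_multiple by blast
  qed
  have "P dvd int n" if "w \<in> reps n" "P dvd fst w" "P dvd snd w" for w
    using F_multiple[OF that(2,3)] that(1) dvd_trans[of P "P^2"]
    by (simp add: reps_def power2_eq_square) (metis dvd_mult_left of_nat_dvd_iff of_nat_mult)
  then have "?A \<inter> ?B = {}" by auto
  then have "card {w \<in> reps n. inlat h (fst w) (snd w)} = card ?A + card ?B"
    unfolding eq using finite_reps[of n] by (intro card_Un_disjoint) auto
  then show ?thesis unfolding theta_sub using card_reps_multiples[of n] by simp
qed

text \<open>Q is the genus condition as a property of n alone. For n prime to p each representing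
  vector lies in exactly one sublattice, necessarily good, so either all representations of n are
  counted once or none is.\<close>

lemma sum_theta_Psi_Int:
  assumes cond: "\<And>h x y. h \<in> {0..P} \<Longrightarrow> inlat h x y \<Longrightarrow> F x y = int n \<Longrightarrow> \<not> p dvd n \<Longrightarrow>
      cls (sub h) \<in> G \<longleftrightarrow> Q"
  shows "wD \<Delta> * (\<Sum>C\<in>Psi p (a,b,c) \<inter> G. theta_cls C n) =
    wD \<Delta> * real (card (Psi p (a,b,c) \<inter> G)) * theta_pow (a,b,c) (p^2) n +
    (if \<not> p dvd n \<and> Q then theta (a,b,c) n else 0)"
proof -
  define B where "B = (\<lambda>h. {w \<in> reps n. \<not> p dvd n \<and> inlat h (fst w) (snd w)})"
  have nz: "\<not> (P dvd fst w \<and> P dvd snd w)" if "w \<in> reps n" "\<not> p dvd n" for w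
    using not_dvd_F[of "fst w" "snd w"] that by (simp add: reps_def)
  have "wD \<Delta> * (\<Sum>C\<in>Psi p (a,b,c) \<inter> G. theta_cls C n) = (\<Sum>h\<in>good_in G. theta (sub h) n)"
    by (simp add: sum_Psi_Int theta_cls_eq)
  also have "\<dots> = (\<Sum>h\<in>good_in G. theta_pow (a,b,c) (p^2) n + real (card (B h)))"
    unfolding B_def by (rule sum.cong[OF refl]) (simp add: theta_sub_good good_in_def)
  also have "\<dots> = real (card (good_in G)) * theta_pow (a,b,c) (p^2) n
      + real (\<Sum>h\<in>good_in G. card (B h))"
    by (simp add: sum.distrib)
  also have "real (card (good_in G)) = wD \<Delta> * real (card (Psi p (a,b,c) \<inter> G))"
    using sum_Psi_Int[where G = G and \<phi> = "\<lambda>_. 1"] by simp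
  also have "(\<Sum>h\<in>good_in G. card (B h)) = card (\<Union>h\<in>good_in G. B h)"
  proof (rule card_UN_disjoint[symmetric])
    show "\<forall>i\<in>good_in G. \<forall>j\<in>good_in G. i \<noteq> j \<longrightarrow> B i \<inter> B j = {}"
      unfolding B_def good_in_def using inlat_unique nz by blast
  qed (use finite_reps[of n] finite_good_in in \<open>auto simp: B_def\<close>)
  also have "(\<Union>h\<in>good_in G. B h) = (if \<not> p dvd n \<and> Q then reps n else {})"
  proof (cases "\<not> p dvd n \<and> Q")
    case True
    have "w \<in> (\<Union>h\<in>good_in G. B h)" if w: "w \<in> reps n" for w
    proof -
      obtain h where h: "h \<in> {0..P}" "inlat h (fst w) (snd w)"
        using inlat_exists nz[OF w] True by blast
      have F: "F (fst w) (snd w) = int n" using w by (simp add: reps_def)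
      then have "good h" using goodI[OF h(2)] True by simp
      moreover have "cls (sub h) \<in> G" using cond[OF h F] True by blast
      ultimately show ?thesis using h w True by (auto simp: good_in_def B_def)
    qed
    then show ?thesis using True by (auto simp: B_def)
  next
    case False
    then show ?thesis unfolding B_def good_in_def using cond by (auto simp: reps_def)
  qed
  finally show ?thesis by (auto simp: theta_eq_card_reps)
qed

text \<open>Replaces the unknown form defining the genus by a sublattice form already known to lie
  in it.\<close>

lemma cls_sub_in_genus_iff:
  assumes "i \<in> good_in (genus (\<Delta> * P^2) f)" "good h"
  shows "cls (sub h) \<in> genus (\<Delta> * P^2) f \<longleftrightarrow> genus_rel (\<Delta> * P^2) (sub i) (sub h)"
proof -
  have 1: "cls (sub j) \<in> genus (\<Delta> * P^2) f \<longleftrightarrow> genus_rel (\<Delta> * P^2) f (sub j)" if "good j" for j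
    using cls_in_genus_iff[OF _ posdef_sub disc_sub] that primitive_sub_iff by blast
  have "good i" "cls (sub i) \<in> genus (\<Delta> * P^2) f" using assms(1) by (simp_all add: good_in_def)
  then have fi: "genus_rel (\<Delta> * P^2) f (sub i)" using 1 by blast
  show ?thesis
    using 1[OF assms(2)] genus_rel_trans[OF fi] genus_rel_trans[OF genus_rel_sym[OF fi]] by blast
qed

end

section \<open>Residue conditions on n and the final identities\<close>

lemma sum_Legendre_Pop:
  assumes p: "prime p" and r: "\<not> int p dvd r"
  shows "(\<Sum>i=1..p-1. ((real_of_int (Legendre (r * int i) (int p)) + 1) / 2) * Pop p i f n)
    = (if \<not> p dvd n \<and> QuadRes (int p) (r * int n) then theta f n else 0)"
proof (cases "p dvd n")
  case True
  then have "Pop p i f n = 0" if "i \<in> {1..p-1}" for i using that by (simp add: Pop_def)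
  then show ?thesis using True by simp
next
  case False
  define i where "i = n mod p"
  have p1: "p > 1" using p prime_gt_1_nat by blast
  then have "n mod p < p" by simp
  moreover have "n mod p \<noteq> 0" using False by (simp add: dvd_eq_mod_eq_0)
  ultimately have i: "i \<in> {1..p-1}" unfolding i_def atLeastAtMost_iff by linarith
  have c: "[r * int i = r * int n] (mod int p)"
    by (simp add: i_def zmod_int cong_def mod_mult_right_eq)
  have "\<not> int p dvd r * int n"
    using False r p by (simp add: prime_dvd_mult_iff)
  then have "\<not> [r * int i = 0] (mod int p)"
    using c cong_trans cong_sym cong_0_iff by blast
  moreover have "QuadRes (int p) (r * int i) \<longleftrightarrow> QuadRes (int p) (r * int n)"
    unfolding QuadRes_def using c cong_trans cong_sym by blast
  \<comment> \<open>As p does not divide r i, half the symbol plus one is the indicator of a square;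
    only the residue i of n contributes to the sum.\<close>
  ultimately have L: "(real_of_int (Legendre (r * int i) (int p)) + 1) / 2
      = (if QuadRes (int p) (r * int n) then 1 else 0)"
    by (simp add: Legendre_def)
  have "(\<Sum>j=1..p-1. ((real_of_int (Legendre (r * int j) (int p)) + 1) / 2) * Pop p j f n)
    = (\<Sum>j=1..p-1. if i = j then ((real_of_int (Legendre (r * int j) (int p)) + 1) / 2) * theta f n else 0)"
    by (rule sum.cong) (auto simp: Pop_def i_def)
  also have "\<dots> = ((real_of_int (Legendre (r * int i) (int p)) + 1) / 2) * theta f n"
    using i by simp
  finally show ?thesis unfolding L using False by simp
qed

theorem theorem6p1:
  fixes a b c :: int and p :: nat and r :: int and G :: "form set set"
  defines "\<Delta> \<equiv> b^2 - 4*a*c"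
  defines "PsiG \<equiv> Psi p (a,b,c) \<inter> G"
  assumes prim: "primitive (a,b,c)" and apos: "a > 0" and dneg: "\<Delta> < 0"
    and pp: "prime p"
    and G: "is_genus (\<Delta> * int p^2) G"
    and ne: "PsiG \<noteq> {}"
    and rpos: "r > 0" and rcop: "coprime r (\<Delta> * int p^2)"
    and rrep: "\<exists>C\<in>PsiG. \<exists>f\<in>C. represents f r"
  shows "(odd p \<longrightarrow> (\<forall>n. wD \<Delta> * (\<Sum>C\<in>PsiG. theta_cls C n)
             = wD \<Delta> * real (card PsiG) * theta_pow (a,b,c) (p^2) n
               + (\<Sum>i=1..p-1. ((real_of_int (Legendre (r * int i) (int p)) + 1) / 2)
                               * Pop p i (a,b,c) n)))
       \<and> (p = 2 \<longrightarrow> (\<forall>n. let t = (if 16 dvd \<Delta> then 2 else if odd \<Delta> then 0 else (1::nat))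
                      in wD \<Delta> * (\<Sum>C\<in>PsiG. theta_cls C n)
             = wD \<Delta> * real (card PsiG) * theta_pow (a,b,c) 4 n
               + Pop (2^(t+1)) (nat (r mod 2^(t+1))) (a,b,c) n))"
proof -
  interpret S: sublattice_forms a b c p
    using prim apos dneg pp unfolding \<Delta>_def by unfold_locales
  obtain f where f: "G = genus (\<Delta> * int p^2) f" using G unfolding is_genus_def by blast
  obtain C g where C: "C \<in> PsiG" "g \<in> C" "represents g r" using rrep by blast
  obtain i where i: "i \<in> S.good_in G" "C = cls (S.sub i)"
    using C(1) unfolding PsiG_def S.Psi_Int by blast
  have i_range: "i \<in> {0..int p}" using i(1) by (simp add: S.good_in_def)
  \<comment> \<open>Reading r through the equivalence and the basis of sublattice i gives a vector
    (x, y) of that sublattice with value r. The genus of every other sublattice is tested against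
    it.\<close>
  obtain al be ga de where "g = transf (S.sub i) al be ga de"
    using C(2) i(2) unfolding cls_def sl2_equiv_def by blast
  then obtain x y where xy: "S.inlat i x y" "fval (a,b,c) x y = r"
    using C(3) unfolding represents_def fval_transf S.inlat_iff by (metis S.fval_sub fval_transf)
  have "coprime r (int p)" using rcop pp by (auto simp: power2_eq_square)
  then have rp: "\<not> int p dvd r"
    using S.P_gt_1 coprime_common_divisor[of r "int p" "int p"] by auto
  have mem: "cls (S.sub h) \<in> G \<longleftrightarrow> genus_rel (\<Delta> * int p^2) (S.sub i) (S.sub h)"
    if "S.inlat h x' y'" "fval (a,b,c) x' y' = int n" "\<not> p dvd n" for h x' y' n
    using S.cls_sub_in_genus_iff[of i f h] S.goodI[OF that(1)] that i(1) f unfolding \<Delta>_def by simp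
  note rF = rp[folded xy(2)]
  show ?thesis
  proof (intro conjI impI allI)
    fix n assume odd: "odd p"
    have cond: "cls (S.sub h) \<in> G \<longleftrightarrow> QuadRes (int p) (r * int n)"
      if "h \<in> {0..int p}" "S.inlat h x' y'" "fval (a,b,c) x' y' = int n" "\<not> p dvd n" for h x' y'
      using mem[OF that(2-4)] S.genus_rel_odd_iff[OF odd xy(1) that(2) rF] that(3,4)
      unfolding xy(2) \<Delta>_def by simp
    show "wD \<Delta> * (\<Sum>C\<in>PsiG. theta_cls C n)
      = wD \<Delta> * real (card PsiG) * theta_pow (a,b,c) (p^2) n
        + (\<Sum>i=1..p-1. ((real_of_int (Legendre (r * int i) (int p)) + 1) / 2)
                               * Pop p i (a,b,c) n)"
      unfolding sum_Legendre_Pop[OF pp rp] PsiG_def \<Delta>_def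
      by (rule S.sum_theta_Psi_Int) (rule cond)
  next
    fix n assume p2: "p = 2"
    define t :: nat where "t = (if 16 dvd \<Delta> then 2 else if odd \<Delta> then 0 else 1)"
    have t: "S.texp = t" by (simp only: S.texp_def t_def \<Delta>_def)
    have cond: "cls (S.sub h) \<in> G \<longleftrightarrow> [r = int n] (mod 2^(t + 1))"
      if "h \<in> {0..int p}" "S.inlat h x' y'" "fval (a,b,c) x' y' = int n" "\<not> p dvd n" for h x' y'
      using mem[OF that(2-4)] S.genus_rel_two_iff[OF p2 i_range that(1) xy(1) that(2) rF] that(3,4)
      unfolding xy(2) \<Delta>_def t by simp
    have cong: "[r = int n] (mod 2^(t + 1)) \<longleftrightarrow> n mod 2^(t + 1) = nat (r mod 2^(t + 1))"
    proof -
      have "n mod 2^(t + 1) = nat (r mod 2^(t + 1)) \<longleftrightarrow> int (n mod 2^(t + 1)) = r mod 2^(t + 1)"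
        by auto
      also have "int (n mod 2^(t + 1)) = int n mod 2^(t + 1)" by (simp add: zmod_int)
      finally show ?thesis by (auto simp: cong_def)
    qed
    \<comment> \<open>Since r is odd, the residue condition already makes n odd.\<close>
    have odd_n: "\<not> p dvd n" if "[r = int n] (mod 2^(t + 1))"
    proof -
      have "[r = int n] (mod 2)" using that by (rule cong_dvd_modulus) simp
      then show ?thesis using rp p2 cong_dvd_iff by fastforce
    qed
    have "(if \<not> p dvd n \<and> [r = int n] (mod 2^(t + 1)) then theta (a,b,c) n else 0)
        = Pop (2^(t + 1)) (nat (r mod 2^(t + 1))) (a,b,c) n"
      using odd_n cong unfolding Pop_def by presburger
    moreover have "wD \<Delta> * (\<Sum>C\<in>PsiG. theta_cls C n)
      = wD \<Delta> * real (card PsiG) * theta_pow (a,b,c) (p^2) n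
        + (if \<not> p dvd n \<and> [r = int n] (mod 2^(t + 1)) then theta (a,b,c) n else 0)"
      unfolding PsiG_def \<Delta>_def by (rule S.sum_theta_Psi_Int) (rule cond)
    moreover have "p^2 = 4" using p2 by simp
    ultimately show "let t = (if 16 dvd \<Delta> then 2 else if odd \<Delta> then 0 else (1::nat))
        in wD \<Delta> * (\<Sum>C\<in>PsiG. theta_cls C n)
             = wD \<Delta> * real (card PsiG) * theta_pow (a,b,c) 4 n
               + Pop (2^(t+1)) (nat (r mod 2^(t+1))) (a,b,c) n"
      unfolding Let_def t_def[symmetric] by (simp only:)
  qed
qed

end
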